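(* Fix any $\frac{1}{\sqrt{n}}\le\epsilon\le 1$. There is $\epsilon_0=\tilde{\Theta}(\epsilon)$ such that, given $\mathbf{A}\in\mathbb{R}^{n\times n}$ with $\|\mathbf{A}\|_\infty\le 1$, any non-adaptive sampling algorithm which distinguishes with probability at least $3/4$ between the cases (1) $\|\mathbf{A}\|_{\mathcal{S}_1}>\epsilon_0 n^{1.5}$ and (2) $\|\mathbf{A}\|_{\mathcal{S}_1}<\epsilon_0 n^{1.5}-\epsilon n^{1.5}$, must query at least $\tilde{\Omega}(1/\epsilon^4)$ entries of $\mathbf{A}$.
   Context: $\|\mathbf{A}\|_\infty=\max_{i,j}|\mathbf{A}_{i,j}|$. The Schatten-1 norm is $\|\mathbf{A}\|_{\mathcal{S}_1}=\sum_i\sigma_i(\mathbf{A})$, the sum of singular values. A non-adaptive sampling algorithm fixes its queried entries before seeing any answers. $\tilde{\Theta},\tilde{\Omega}$ hide polylogarithmic factors in $1/\epsilon$. *)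

theory Defs
  imports
    "HOL-Probability.Probability"
    "HOL-Library.Landau_Symbols"
    "Jordan_Normal_Form.Char_Poly"
begin

definition max_norm :: "real mat \<Rightarrow> real" where
  "max_norm A = Max (abs ` elements_mat A)"

text \<open>
  The singular values are the square roots of the eigenvalues of \<open>A\<^sup>T A\<close>, counted with
  multiplicity.  As \<open>A\<^sup>T A\<close> is real symmetric and positive semidefinite, all roots of its
  characteristic polynomial are real and nonnegative, so \<open>proots\<close> over the reals misses none.
\<close>

definition singular_values :: "real mat \<Rightarrow> real multiset" where
  "singular_values A = image_mset sqrt (proots (char_poly (transpose_mat A * A)))"

definition schatten1 :: "real mat \<Rightarrow> real" where
  "schatten1 A = (\<Sum>\<sigma>\<in>#singular_values A. \<sigma>)"

definition inputs :: "nat \<Rightarrow> real mat set" where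
  "inputs n = {A \<in> carrier_mat n n. max_norm A \<le> 1}"

text \<open>
  A deterministic non-adaptive algorithm is a set of positions fixed in advance together with a
  decision made from the values found there; \<open>restrict\<close> hides all other entries.
  The answer \<open>True\<close> stands for case (1), \<open>False\<close> for case (2).
\<close>

type_synonym sampler = "(nat \<times> nat) set \<times> ((nat \<times> nat \<Rightarrow> real) \<Rightarrow> bool)"

definition run :: "sampler \<Rightarrow> real mat \<Rightarrow> bool" where
  "run a A = (case a of (S, decide) \<Rightarrow> decide (restrict (\<lambda>ij. A $$ ij) S))"

text \<open>
  A randomized non-adaptive algorithm is an arbitrary probability distribution over deterministic
  ones.  The sigma-algebra is left open up to measurability of the events that occur below, so that
  the distribution of a random sampler on any probability space is covered.
\<close>

definition nonadaptive_algorithm :: "nat \<Rightarrow> sampler measure \<Rightarrow> bool" where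
  "nonadaptive_algorithm n M \<longleftrightarrow>
     prob_space M \<and>
     (\<forall>a\<in>space M. fst a \<subseteq> {..<n} \<times> {..<n}) \<and>
     (\<forall>A\<in>inputs n. {a \<in> space M. run a A} \<in> sets M)"

text \<open>Worst case over the internal randomness.\<close>

definition num_queries :: "sampler measure \<Rightarrow> nat" where
  "num_queries M = Max ((\<lambda>a. card (fst a)) ` space M)"

definition distinguishes :: "nat \<Rightarrow> real \<Rightarrow> real \<Rightarrow> sampler measure \<Rightarrow> bool" where
  "distinguishes n \<epsilon>\<^sub>0 \<epsilon> M \<longleftrightarrow>
     (\<forall>A\<in>inputs n.
        (schatten1 A > \<epsilon>\<^sub>0 * real n powr 1.5 \<longrightarrow>
           measure M {a \<in> space M. run a A} \<ge> 3/4) \<and>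
        (schatten1 A < \<epsilon>\<^sub>0 * real n powr 1.5 - \<epsilon> * real n powr 1.5 \<longrightarrow>
           measure M {a \<in> space M. \<not> run a A} \<ge> 3/4))"

definition regime :: "(nat \<times> real) set" where
  "regime = {(n, \<epsilon>). n \<ge> 1 \<and> 1 / sqrt (real n) \<le> \<epsilon> \<and> \<epsilon> \<le> 1}"

text \<open>
  Asymptotics as \<open>1/\<epsilon> \<rightarrow> \<infinity>\<close> within the admissible parameters, uniformly in \<open>n\<close>
  (made explicit by the lemma below).
\<close>

definition eps_to_0 :: "(nat \<times> real) filter" where
  "eps_to_0 = inf (filtercomap snd (at_right 0)) (principal regime)"

lemma eventually_eps_to_0:
  "eventually P eps_to_0 \<longleftrightarrow> (\<exists>\<delta>>0. \<forall>(n, \<epsilon>)\<in>regime. \<epsilon> < \<delta> \<longrightarrow> P (n, \<epsilon>))"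
proof -
  have pos: "\<epsilon> > 0" if "(n, \<epsilon>) \<in> regime" for n \<epsilon>
  proof -
    have "0 < 1 / sqrt (real n)" "1 / sqrt (real n) \<le> \<epsilon>"
      using that by (auto simp: regime_def)
    then show ?thesis by linarith
  qed
  show ?thesis
  proof
    assume "eventually P eps_to_0"
    then obtain Q where Q: "eventually Q (at_right (0::real))"
      and QP: "\<And>x. Q (snd x) \<Longrightarrow> x \<in> regime \<Longrightarrow> P x"
      unfolding eps_to_0_def eventually_inf_principal eventually_filtercomap by blast
    from Q obtain \<delta> where "\<delta> > 0" "\<And>y. 0 < y \<Longrightarrow> y < \<delta> \<Longrightarrow> Q y"
      unfolding eventually_at_right_field by blast
    then show "\<exists>\<delta>>0. \<forall>(n, \<epsilon>)\<in>regime. \<epsilon> < \<delta> \<longrightarrow> P (n, \<epsilon>)"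
      using QP pos by (intro exI[of _ \<delta>]) auto
  next
    assume "\<exists>\<delta>>0. \<forall>(n, \<epsilon>)\<in>regime. \<epsilon> < \<delta> \<longrightarrow> P (n, \<epsilon>)"
    then obtain \<delta> where \<delta>: "\<delta> > 0" "\<And>n \<epsilon>. (n, \<epsilon>) \<in> regime \<Longrightarrow> \<epsilon> < \<delta> \<Longrightarrow> P (n, \<epsilon>)"
      by blast
    have "eventually (\<lambda>y. y < \<delta>) (at_right (0::real))"
      unfolding eventually_at_right_field using \<delta>(1) by blast
    then show "eventually P eps_to_0"
      unfolding eps_to_0_def eventually_inf_principal eventually_filtercomap
      using \<delta>(2) by (intro exI[of _ "\<lambda>y. y < \<delta>"]) auto
  qed
qed

lemma eps_to_0_neq_bot: "eps_to_0 \<noteq> bot"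
proof
  assume "eps_to_0 = bot"
  then have "eventually (\<lambda>_. False) eps_to_0" by simp
  then obtain \<delta> where "\<delta> > 0" and no: "\<And>n \<epsilon>. (n, \<epsilon>) \<in> regime \<Longrightarrow> \<not> \<epsilon> < \<delta>"
    unfolding eventually_eps_to_0 by blast
  obtain m :: nat where m: "m > 0" "inverse (real m) < \<delta>"
    using ex_inverse_of_nat_less[OF \<open>\<delta> > 0\<close>] by blast
  have "(m\<^sup>2, inverse (real m)) \<in> regime"
    using m(1) by (auto simp: regime_def real_sqrt_power field_simps)
  with no m(2) show False by blast
qed

text \<open>Landau symbols up to polylogarithmic factors in \<open>1/\<epsilon>\<close>.\<close>

definition soft_bigo :: "(nat \<times> real \<Rightarrow> real) \<Rightarrow> (nat \<times> real \<Rightarrow> real) set" where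
  "soft_bigo g = (\<Union>k::nat. O[eps_to_0](\<lambda>(n, \<epsilon>). g (n, \<epsilon>) * ln (1 / \<epsilon>) ^ k))"

definition soft_bigomega :: "(nat \<times> real \<Rightarrow> real) \<Rightarrow> (nat \<times> real \<Rightarrow> real) set" where
  "soft_bigomega g = (\<Union>k::nat. \<Omega>[eps_to_0](\<lambda>(n, \<epsilon>). g (n, \<epsilon>) / ln (1 / \<epsilon>) ^ k))"

definition soft_bigtheta :: "(nat \<times> real \<Rightarrow> real) \<Rightarrow> (nat \<times> real \<Rightarrow> real) set" where
  "soft_bigtheta g = soft_bigo g \<inter> soft_bigomega g"

end

theory Submission
  imports Defs "HOL-Number_Theory.Cong"
begin

text \<open>
  A cycle matrix \<open>diag(s\<^sub>1, \<dots>, s\<^sub>K)\<close> plus a cyclic shift has singular values that depend on the signs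
  \<open>s\<^sub>i\<close> only through their product, and for odd \<open>K\<close> its Schatten-1 norm is \<open>2 / sin h\<close> or
  \<open>2 cot h\<close>, with \<open>h = \<pi> / (2K)\<close>, according as the product is \<open>1\<close> or \<open>-1\<close>.  The hard input is a direct
  sum of \<open>M\<close> such cycles with random signs of a common product, every entry being blown up to a
  \<open>k \<times> k\<close> orthogonal matrix with flat entries (the discrete Hartley matrix); the place of each
  cycle is hidden by independent random cyclic shifts of the row and column blocks.  Missing a single
  sign of a cycle makes the two products indistinguishable.  A set of at most \<open>M\<^sup>2 / 2\<close> queries contains
  all \<open>K\<close> signs of a given cycle with probability at most \<open>2\<^sup>-\<^sup>K\<close>, which beats the union bound over
  the \<open>M\<close> cycles once \<open>K\<close> is logarithmic in \<open>1/\<epsilon>\<close>.  The gap of the norms is then at least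
  \<open>\<epsilon> n\<^sup>1\<^sup>.\<^sup>5\<close> for \<open>M\<close> of order \<open>1 / (K\<^sup>5 \<epsilon>\<^sup>2)\<close>.
\<close>

subsection \<open>Schatten-1 norm from a singular system\<close>

text \<open>The two relations combine to \<open>A\<^sup>T A V = V D\<^sup>2\<close> with
  \<open>D = mat_diag n \<sigma>\<close>, which diagonalises \<open>A\<^sup>T A\<close>. Entries of
  \<sigma> may be negative, hence the absolute values.\<close>

lemma schatten1_eq_sum_of_singular_system:
  fixes A U V :: "real mat"
  assumes A: "A \<in> carrier_mat n n" and U: "U \<in> carrier_mat n n" and V: "V \<in> carrier_mat n n"
    and orth: "transpose_mat V * V = 1\<^sub>m n"
    and AV: "A * V = U * mat_diag n \<sigma>"
    and AU: "transpose_mat A * U = V * mat_diag n \<sigma>"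
  shows "schatten1 A = (\<Sum>j<n. \<bar>\<sigma> j\<bar>)"
proof -
  let ?D = "mat_diag n \<sigma>" and ?D2 = "mat_diag n (\<lambda>j. (\<sigma> j)\<^sup>2)"
  let ?At = "transpose_mat A" and ?Vt = "transpose_mat V"
  have At: "?At \<in> carrier_mat n n" and Vt: "?Vt \<in> carrier_mat n n" and D: "?D \<in> carrier_mat n n"
    and D2: "?D2 \<in> carrier_mat n n"
    using A V by auto
  have orth': "V * ?Vt = 1\<^sub>m n"
    using mat_mult_left_right_inverse[OF Vt V orth] .
  have DD: "?D * ?D = ?D2"
    by (simp add: power2_eq_square)
  have "(?At * A) * V = ?At * (A * V)" using At A V by (simp add: assoc_mult_mat[of _ n n _ n _ n])
  also have "\<dots> = (?At * U) * ?D" unfolding AV using At U D by (simp add: assoc_mult_mat[of _ n n _ n _ n])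
  also have "\<dots> = V * ?D2" unfolding AU DD[symmetric] using V D by (simp add: assoc_mult_mat[of _ n n _ n _ n])
  finally have *: "(?At * A) * V = V * ?D2" .
  have "?At * A = (?At * A) * (V * ?Vt)" unfolding orth' using At A by simp
  also have "\<dots> = ((?At * A) * V) * ?Vt" using At A V Vt by (simp add: assoc_mult_mat[of _ n n _ n _ n])
  finally have "?At * A = V * ?D2 * ?Vt" unfolding * .
  then have "similar_mat (?At * A) ?D2"
    by (intro similar_matI[of _ _ V ?Vt n]) (use At A V Vt orth orth' in auto)
  then have "char_poly (?At * A) = char_poly ?D2" by (rule char_poly_similar)
  also have "\<dots> = (\<Prod>a\<leftarrow>diag_mat ?D2. [:- a, 1:])"
    by (rule char_poly_upper_triangular[OF D2]) (auto simp: mat_diag_def)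
  also have "diag_mat ?D2 = map (\<lambda>j. (\<sigma> j)\<^sup>2) [0..<n]"
    by (auto simp: diag_mat_def mat_diag_def)
  also have "(\<Prod>a\<leftarrow>\<dots>. [:- a, 1:]) = (\<Prod>j<n. [:- ((\<sigma> j)\<^sup>2), 1:])"
    by (simp add: prod.distinct_set_conv_list[symmetric] atLeast0LessThan comp_def)
  finally have "proots (char_poly (?At * A)) = (\<Sum>j<n. {#(\<sigma> j)\<^sup>2#})"
    by (simp add: proots_prod)
  then have "singular_values A = image_mset sqrt (\<Sum>j<n. {#(\<sigma> j)\<^sup>2#})"
    by (simp add: singular_values_def)
  also have "\<dots> = (\<Sum>j<n. {#\<bar>\<sigma> j\<bar>#})"
    by (induction n) auto
  finally have "singular_values A = (\<Sum>j<n. {#\<bar>\<sigma> j\<bar>#})" .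
  moreover have "sum_mset (\<Sum>j<m. {#f j#}) = (\<Sum>j<m. f j)" for m and f :: "nat \<Rightarrow> real"
    by (induction m) auto
  ultimately show ?thesis by (simp add: schatten1_def)
qed

text \<open>Enumerating rows and columns by different bijections onto \<open>I\<close> does not
  affect singular values, dividing by \<open>sqrt w\<close> normalises the vectors, and the zero
  padding contributes only zero singular values.\<close>

lemma schatten1_eq_sum_of_indexed_singular_system:
  fixes F U V :: "'a \<Rightarrow> 'a \<Rightarrow> real" and \<sigma> :: "'a \<Rightarrow> real"
  assumes "N \<le> n" and \<rho>: "bij_betw \<rho> {..<N} I" and \<gamma>: "bij_betw \<gamma> {..<N} I"
    and orth: "\<And>i j. i \<in> I \<Longrightarrow> j \<in> I \<Longrightarrow> (\<Sum>c\<in>I. V c i * V c j) = (if i = j then w else 0)"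
    and "w > 0"
    and FV: "\<And>r j. r \<in> I \<Longrightarrow> j \<in> I \<Longrightarrow> (\<Sum>c\<in>I. F r c * V c j) = U r j * \<sigma> j"
    and FU: "\<And>c j. c \<in> I \<Longrightarrow> j \<in> I \<Longrightarrow> (\<Sum>r\<in>I. F r c * U r j) = V c j * \<sigma> j"
  shows "schatten1 (Matrix.mat n n (\<lambda>(p, q). if p < N \<and> q < N then F (\<rho> p) (\<gamma> q) else 0))
    = (\<Sum>j\<in>I. \<bar>\<sigma> j\<bar>)"
proof -
  \<comment> \<open>Padding by the identity keeps \<open>V'\<close> orthogonal; the zero part of
    \<open>A\<close> is matched by the zeros of \<open>\<sigma>'\<close>.\<close>
  define ext where "ext f = Matrix.mat n n (\<lambda>(p, q). if p < N \<and> q < N then f p q else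
     if p = q then 1 else (0::real))" for f
  define A where "A = Matrix.mat n n (\<lambda>(p, q). if p < N \<and> q < N then F (\<rho> p) (\<gamma> q) else 0)"
  define V' where "V' = ext (\<lambda>q j. V (\<gamma> q) (\<gamma> j) / sqrt w)"
  define U' where "U' = ext (\<lambda>p j. U (\<rho> p) (\<gamma> j) / sqrt w)"
  define \<sigma>' where "\<sigma>' = (\<lambda>j. if j < N then \<sigma> (\<gamma> j) else 0)"
  have split: "(\<Sum>i = 0..<n. f i) = (\<Sum>i<N. f i) + (\<Sum>i\<in>{N..<n}. f i)" for f :: "nat \<Rightarrow> real"
    using sum.atLeastLessThan_concat[of 0 N n f] \<open>N \<le> n\<close> by (simp only: atLeast0LessThan[symmetric])
  have \<rho>_in: "\<rho> p \<in> I" and \<gamma>_in: "\<gamma> p \<in> I" if "p < N" for p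
    using bij_betw_apply[OF \<rho>] bij_betw_apply[OF \<gamma>] that by blast+
  have \<gamma>_inj: "\<gamma> p = \<gamma> q \<longleftrightarrow> p = q" if "p < N" "q < N" for p q
    using inj_on_eq_iff[OF bij_betw_imp_inj_on[OF \<gamma>]] that by simp
  have A_at: "A $$ (p, q) = (if p < N \<and> q < N then F (\<rho> p) (\<gamma> q) else 0)"
    and V'_at: "V' $$ (p, q) = (if p < N \<and> q < N then V (\<gamma> p) (\<gamma> q) / sqrt w else if p = q then 1 else 0)"
    and U'_at: "U' $$ (p, q) = (if p < N \<and> q < N then U (\<rho> p) (\<gamma> q) / sqrt w else if p = q then 1 else 0)"
    if "p < n" "q < n" for p q
    using that by (simp_all add: A_def V'_def U'_def ext_def)
  note sum\<rho> = sum.reindex_bij_betw[OF \<rho>] and sum\<gamma> = sum.reindex_bij_betw[OF \<gamma>]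
  have orthV: "transpose_mat V' * V' = 1\<^sub>m n"
  proof (rule eq_matI)
    fix i j assume "i < dim_row (1\<^sub>m n :: real mat)" "j < dim_col (1\<^sub>m n :: real mat)"
    then have "i < n" "j < n" by simp_all
    then have "(transpose_mat V' * V') $$ (i, j) = (\<Sum>c = 0..<n. V' $$ (c, i) * V' $$ (c, j))"
      by (simp add: V'_def ext_def scalar_prod_def)
    also have "\<dots> = (if i = j then 1 else 0)"
    proof (cases "i < N \<and> j < N")
      case True
      have "(\<Sum>c<N. V' $$ (c, i) * V' $$ (c, j)) = (\<Sum>c<N. V (\<gamma> c) (\<gamma> i) * V (\<gamma> c) (\<gamma> j)) / w"
        unfolding sum_divide_distrib
        by (rule sum.cong) (use True \<open>i < n\<close> \<open>j < n\<close> \<open>N \<le> n\<close> \<open>w > 0\<close> in \<open>auto simp: V'_at\<close>)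
      also have "\<dots> = (\<Sum>c\<in>I. V c (\<gamma> i) * V c (\<gamma> j)) / w"
        by (simp add: sum\<gamma>[of "\<lambda>c. V c (\<gamma> i) * V c (\<gamma> j)"])
      also have "\<dots> = (if i = j then 1 else 0)"
        using True \<open>w > 0\<close> by (simp add: orth \<gamma>_in \<gamma>_inj)
      finally have "(\<Sum>c<N. V' $$ (c, i) * V' $$ (c, j)) = (if i = j then 1 else 0)" .
      moreover have "(\<Sum>c\<in>{N..<n}. V' $$ (c, i) * V' $$ (c, j)) = 0"
        by (rule sum.neutral) (use True \<open>i < n\<close> \<open>j < n\<close> in \<open>simp add: V'_at\<close>)
      ultimately show ?thesis using split[of "\<lambda>c. V' $$ (c, i) * V' $$ (c, j)"] by linarith
    next
      \<comment> \<open>One of the columns \<open>i\<close>, \<open>j\<close> of \<open>V'\<close>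
        is now a unit vector, so at most the term \<open>c = i\<close> survives.\<close>
      case False
      have "(\<Sum>c = 0..<n. V' $$ (c, i) * V' $$ (c, j)) =
          (\<Sum>c = 0..<n. if c = i then if i = j then 1 else 0 else 0)"
      proof (rule sum.cong[OF refl])
        fix c assume "c \<in> {0..<n}"
        then have "c < n" by simp
        note V' = V'_at[OF \<open>c < n\<close> \<open>i < n\<close>] V'_at[OF \<open>c < n\<close> \<open>j < n\<close>]
        show "V' $$ (c, i) * V' $$ (c, j) = (if c = i then if i = j then 1 else 0 else 0)"
        proof (cases "i < N")
          case True
          with False have "\<not> j < N" by simp
          with True show ?thesis unfolding V' by (cases "c = j"; cases "c = i") simp_all
        next
          case False
          then show ?thesis unfolding V' by (cases "c = i") simp_all
        qed
      qed
      then show ?thesis using \<open>i < n\<close> by simp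
    qed
    finally show "(transpose_mat V' * V') $$ (i, j) = 1\<^sub>m n $$ (i, j)"
      using \<open>i < n\<close> \<open>j < n\<close> by simp
  qed (simp_all add: V'_def ext_def)
  have AV: "A * V' = U' * mat_diag n \<sigma>'"
  proof (rule eq_matI)
    fix p j assume "p < dim_row (U' * mat_diag n \<sigma>')" "j < dim_col (U' * mat_diag n \<sigma>')"
    then have pj: "p < n" "j < n" by (simp_all add: U'_def ext_def mat_diag_def)
    have "(A * V') $$ (p, j) = (\<Sum>c = 0..<n. A $$ (p, c) * V' $$ (c, j))"
      using pj by (simp add: A_def V'_def ext_def scalar_prod_def)
    also have "\<dots> = U' $$ (p, j) * \<sigma>' j"
    proof (cases "p < N \<and> j < N")
      case True
      have "(\<Sum>c<N. A $$ (p, c) * V' $$ (c, j)) = (\<Sum>c<N. F (\<rho> p) (\<gamma> c) * V (\<gamma> c) (\<gamma> j)) / sqrt w"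
        unfolding sum_divide_distrib
        by (rule sum.cong) (use True pj \<open>N \<le> n\<close> in \<open>auto simp: A_at V'_at\<close>)
      also have "\<dots> = (\<Sum>c\<in>I. F (\<rho> p) c * V c (\<gamma> j)) / sqrt w"
        by (simp add: sum\<gamma>[of "\<lambda>c. F (\<rho> p) c * V c (\<gamma> j)"])
      also have "\<dots> = U' $$ (p, j) * \<sigma>' j"
        using True pj by (simp add: FV \<gamma>_in \<rho>_in U'_at \<sigma>'_def)
      finally have "(\<Sum>c<N. A $$ (p, c) * V' $$ (c, j)) = U' $$ (p, j) * \<sigma>' j" .
      moreover have "(\<Sum>c\<in>{N..<n}. A $$ (p, c) * V' $$ (c, j)) = 0"
        by (rule sum.neutral) (use pj in \<open>simp add: A_at\<close>)
      ultimately show ?thesis using split[of "\<lambda>c. A $$ (p, c) * V' $$ (c, j)"] by linarith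
    next
      case False
      then have "(\<Sum>c = 0..<n. A $$ (p, c) * V' $$ (c, j)) = 0"
        using pj by (intro sum.neutral) (auto simp: A_at V'_at)
      moreover have "U' $$ (p, j) * \<sigma>' j = 0"
        using False pj by (auto simp: U'_at \<sigma>'_def)
      ultimately show ?thesis by simp
    qed
    also have "\<dots> = (U' * mat_diag n \<sigma>') $$ (p, j)"
      using pj by (subst mat_diag_mult_right[of _ n]) (simp_all add: U'_def ext_def)
    finally show "(A * V') $$ (p, j) = (U' * mat_diag n \<sigma>') $$ (p, j)" .
  qed (simp_all add: A_def U'_def V'_def ext_def mat_diag_def)
  have AU: "transpose_mat A * U' = V' * mat_diag n \<sigma>'"
  proof (rule eq_matI)
    fix c j assume "c < dim_row (V' * mat_diag n \<sigma>')" "j < dim_col (V' * mat_diag n \<sigma>')"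
    then have cj: "c < n" "j < n" by (simp_all add: V'_def ext_def mat_diag_def)
    have "(transpose_mat A * U') $$ (c, j) = (\<Sum>p = 0..<n. A $$ (p, c) * U' $$ (p, j))"
      using cj by (simp add: A_def U'_def ext_def scalar_prod_def)
    also have "\<dots> = V' $$ (c, j) * \<sigma>' j"
    proof (cases "c < N \<and> j < N")
      case True
      have "(\<Sum>p<N. A $$ (p, c) * U' $$ (p, j)) = (\<Sum>p<N. F (\<rho> p) (\<gamma> c) * U (\<rho> p) (\<gamma> j)) / sqrt w"
        unfolding sum_divide_distrib
        by (rule sum.cong) (use True cj \<open>N \<le> n\<close> in \<open>auto simp: A_at U'_at\<close>)
      also have "\<dots> = (\<Sum>p\<in>I. F p (\<gamma> c) * U p (\<gamma> j)) / sqrt w"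
        by (simp add: sum\<rho>[of "\<lambda>p. F p (\<gamma> c) * U p (\<gamma> j)"])
      also have "\<dots> = V' $$ (c, j) * \<sigma>' j"
        using True cj by (simp add: FU \<gamma>_in \<rho>_in V'_at \<sigma>'_def)
      finally have "(\<Sum>p<N. A $$ (p, c) * U' $$ (p, j)) = V' $$ (c, j) * \<sigma>' j" .
      moreover have "(\<Sum>p\<in>{N..<n}. A $$ (p, c) * U' $$ (p, j)) = 0"
        by (rule sum.neutral) (use cj in \<open>simp add: A_at\<close>)
      ultimately show ?thesis using split[of "\<lambda>p. A $$ (p, c) * U' $$ (p, j)"] by linarith
    next
      case False
      then have "(\<Sum>p = 0..<n. A $$ (p, c) * U' $$ (p, j)) = 0"
        using cj by (intro sum.neutral) (auto simp: A_at U'_at)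
      moreover have "V' $$ (c, j) * \<sigma>' j = 0"
        using False cj by (auto simp: V'_at \<sigma>'_def)
      ultimately show ?thesis by simp
    qed
    also have "\<dots> = (V' * mat_diag n \<sigma>') $$ (c, j)"
      using cj by (subst mat_diag_mult_right[of _ n]) (simp_all add: V'_def ext_def)
    finally show "(transpose_mat A * U') $$ (c, j) = (V' * mat_diag n \<sigma>') $$ (c, j)" .
  qed (simp_all add: A_def U'_def V'_def ext_def mat_diag_def)
  have "schatten1 A = (\<Sum>j<n. \<bar>\<sigma>' j\<bar>)"
    by (rule schatten1_eq_sum_of_singular_system[OF _ _ _ orthV AV AU])
      (simp_all add: A_def U'_def V'_def ext_def)
  also have "\<dots> = (\<Sum>j<N. \<bar>\<sigma> (\<gamma> j)\<bar>)"
    using split[of "\<lambda>j. \<bar>\<sigma>' j\<bar>"] by (simp add: \<sigma>'_def atLeast0LessThan)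
  also have "\<dots> = (\<Sum>j\<in>I. \<bar>\<sigma> j\<bar>)" by (rule sum\<gamma>)
  finally show ?thesis by (simp add: A_def)
qed

subsection \<open>Trigonometric sums\<close>

text \<open>The kernel of the Hartley transform, a real counterpart of the complex
  exponential.\<close>

definition cas :: "real \<Rightarrow> real" where "cas x = cos x + sin x"

text \<open>Neighbouring samples of a plane wave add up to a multiple of the midpoint sample; the
  factor \<open>2 * cos y\<close> becomes a singular value of the cycle.\<close>

lemma cas_add_cas: "cas (x + y) + cas (x - y) = 2 * cos y * cas x"
  by (simp add: cas_def cos_add sin_add cos_diff sin_diff algebra_simps)

lemma cas_mult_cas: "cas x * cas y = cos (x - y) + sin (x + y)"
  by (simp add: cas_def cos_diff sin_add algebra_simps)

lemma abs_cas_le: "\<bar>cas x\<bar> \<le> sqrt 2"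
proof -
  have "(cas x)\<^sup>2 \<le> 2"
    using sum_squares_bound[of "cos x" "sin x"] sin_cos_squared_add[of x]
    by (simp add: cas_def power2_sum)
  then show ?thesis by (simp add: real_le_rsqrt)
qed

lemma cas_add_int_pi: "cas (x + of_int m * pi) = (if even m then 1 else -1) * cas x"
  by (simp add: cas_def cos_add sin_add mult.commute[of _ pi])

lemma sum_cis_roots_of_unity:
  fixes d :: int
  assumes "K > 0"
  shows "(\<Sum>i<K. cis (2 * pi * of_int d / real K * real i)) = (if int K dvd d then of_nat K else 0)"
proof -
  let ?x = "2 * pi * of_int d / real K"
  have pow: "cis (?x * real i) = cis ?x ^ i" for i
    unfolding Complex.DeMoivre by (rule arg_cong[where f = cis]) simp
  have one: "cis ?x = 1 \<longleftrightarrow> int K dvd d"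
  proof
    assume "cis ?x = 1"
    then have "cos ?x = 1" by (auto simp: complex_eq_iff)
    then obtain m :: int where "?x = of_int m * 2 * pi" using cos_one_2pi_int by blast
    then have "real_of_int d = of_int (m * int K)" using \<open>K > 0\<close> by (simp add: field_simps)
    then have "d = m * int K" by (simp only: of_int_eq_iff)
    then show "int K dvd d" by simp
  next
    assume "int K dvd d"
    then obtain m where "d = int K * m" by blast
    then have x: "?x = 2 * pi * of_int m" using \<open>K > 0\<close> by simp
    show "cis ?x = 1" unfolding x by (rule cis_multiple_2pi) simp
  qed
  have "cis ?x ^ K = 1"
  proof -
    have x: "?x * real K = 2 * pi * of_int d" using \<open>K > 0\<close> by simp
    show ?thesis unfolding pow[symmetric] x by (rule cis_multiple_2pi) simp
  qed
  then show ?thesis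
    unfolding pow using one by (cases "int K dvd d") (simp_all add: sum_gp_strict)
qed

text \<open>A product of two \<open>cas\<close> values is the real part of one exponential plus the
  imaginary part of another, and both exponential sums are real. Constraining only sum and
  difference of the frequencies admits odd multiples of \<open>pi / K\<close>, which sign product -1
  requires.\<close>

lemma sum_cas_mult_cas:
  fixes K :: nat and d e :: int
  assumes "K > 0" "\<theta> - \<phi> = 2 * pi * of_int d / real K" "\<theta> + \<phi> = 2 * pi * of_int e / real K"
  shows "(\<Sum>i<K. cas (\<theta> * real i) * cas (\<phi> * real i)) = (if int K dvd d then real K else 0)"
proof -
  have "cas (\<theta> * real i) * cas (\<phi> * real i) =
      Re (cis (2 * pi * of_int d / real K * real i)) + Im (cis (2 * pi * of_int e / real K * real i))" for i
    unfolding cas_mult_cas assms(2,3)[symmetric] by (simp add: left_diff_distrib distrib_right)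
  then have "(\<Sum>i<K. cas (\<theta> * real i) * cas (\<phi> * real i)) =
      Re (\<Sum>i<K. cis (2 * pi * of_int d / real K * real i)) +
      Im (\<Sum>i<K. cis (2 * pi * of_int e / real K * real i))"
    by (simp only: sum.distrib Re_sum Im_sum)
  then show ?thesis
    unfolding sum_cis_roots_of_unity[OF assms(1)] by simp
qed

lemma sum_hartley:
  assumes "u < k" "v < k"
  shows "(\<Sum>t<k. cas (2 * pi * real u / real k * real t) * cas (2 * pi * real v / real k * real t))
    = (if u = v then real k else 0)"
proof -
  have "k > 0" using assms by simp
  have "u = v" if "int k dvd int u - int v"
    using zdvd_not_zless[of "int u - int v" "int k"] zdvd_not_zless[of "int v - int u" "int k"] that assms
    by (cases u v rule: linorder_cases) (auto simp: dvd_diff_commute)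
  then have "int k dvd int u - int v \<longleftrightarrow> u = v" by auto
  with sum_cas_mult_cas[OF \<open>k > 0\<close>, of "2 * pi * real u / real k" "2 * pi * real v / real k"
      "int u - int v" "int u + int v"]
  show ?thesis by (simp add: distrib_left right_diff_distrib add_divide_distrib diff_divide_distrib)
qed

text \<open>The factor \<open>2 * sin h\<close> turns each cosine into a difference of sines, and
  the sum telescopes.\<close>

lemma sum_cos_arith_progression:
  "2 * sin h * (\<Sum>j<K. cos (\<alpha> + 2 * real j * h)) = sin (\<alpha> + (2 * real K - 1) * h) - sin (\<alpha> - h)"
proof (induction K)
  case (Suc K)
  let ?x = "\<alpha> + 2 * real K * h"
  have 1: "2 * sin h * cos ?x = sin (?x + h) - sin (?x - h)"
    by (simp add: sin_add sin_diff)
  have 2: "\<alpha> + (2 * real K - 1) * h = ?x - h" "\<alpha> + (2 * real (Suc K) - 1) * h = ?x + h"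
    by (simp_all add: algebra_simps)
  show ?case using Suc 1 unfolding 2 sum.lessThan_Suc distrib_left by linarith
qed simp

section \<open>Elementary inequalities between angles, sines and cosines\<close>

lemma mult_cos_le_sin:
  fixes x :: real
  assumes "0 \<le> x" "x \<le> pi"
  shows "x * cos x \<le> sin x"
proof -
  have "sin 0 - 0 * cos 0 \<le> sin x - x * cos x"
  proof (rule DERIV_nonneg_imp_nondecreasing[OF assms(1)])
    fix y assume "0 \<le> y" "y \<le> x"
    then have "0 \<le> y * sin y" using assms by (simp add: sin_ge_zero)
    moreover have "((\<lambda>x. sin x - x * cos x) has_real_derivative y * sin y) (at y)"
      by (auto intro!: derivative_eq_intros)
    ultimately show "\<exists>d. ((\<lambda>x. sin x - x * cos x) has_real_derivative d) (at y) \<and> 0 \<le> d" by blast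
  qed
  then show ?thesis by simp
qed

text \<open>With \<open>x = h / 2\<close> this is \<open>x * cos x \<le> sin x\<close> multiplied by
  \<open>2 * sin x\<close>. It bounds the gap factor \<open>2 * (1 - cos h) / sin h\<close> from
  below by \<open>h\<close>.\<close>

lemma mult_sin_le_one_minus_cos:
  fixes h :: real
  assumes "0 \<le> h" "h \<le> pi"
  shows "h / 2 * sin h \<le> 1 - cos h"
proof -
  define x where "x = h / 2"
  have x: "0 \<le> x" "x \<le> pi" "h = 2 * x"
    using assms by (auto simp: x_def)
  have "2 * sin x * (x * cos x) \<le> 2 * sin x * sin x"
    using mult_cos_le_sin[OF x(1,2)] x by (intro mult_left_mono) (auto simp: sin_ge_zero)
  then show ?thesis
    unfolding x(3) cos_double_sin sin_double by (simp add: power2_eq_square mult_ac)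
qed

subsection \<open>Signed cycles\<close>

definition cycle_entry :: "nat \<Rightarrow> (nat \<Rightarrow> real) \<Rightarrow> nat \<Rightarrow> nat \<Rightarrow> real" where
  "cycle_entry K s i j = (if j = i then s i else if j = Suc i mod K then 1 else 0)"

text \<open>The partial products \<open>\<Prod>l<i. s l\<close> gauge all signs away except for the total
  product, which becomes a twist of the boundary condition: the singular vectors are plane
  waves whose frequency \<open>\<theta>\<close> is fixed by that twist.\<close>

context
  fixes K :: nat and s :: "nat \<Rightarrow> real" and \<theta> :: real
  assumes K: "2 \<le> K" and s: "\<And>i. i < K \<Longrightarrow> s i * s i = 1"
    and twist: "\<And>x. cas (x + real K * \<theta>) = (\<Prod>i<K. s i) * cas x"
begin

lemma sign_prod_square: "i \<le> K \<Longrightarrow> (\<Prod>l<i. s l) * (\<Prod>l<i. s l) = 1"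
  using s by (simp add: prod.distrib[symmetric])

text \<open>Row \<open>i\<close> meets the columns \<open>i\<close> and \<open>i + 1\<close>; after
  the gauge the two samples of the wave add up to the sample at the half-integer position between
  them.\<close>

lemma cycle_right_singular_vector:
  assumes "i < K"
  shows "(\<Sum>j<K. cycle_entry K s i j * ((\<Prod>l<j. s l) * cas (\<theta> * real j))) =
    (\<Prod>l<Suc i. s l) * cas (\<theta> * (real i + 1 / 2)) * (2 * cos (\<theta> / 2))"
proof -
  define w where "w j = (\<Prod>l<j. s l) * cas (\<theta> * real j)" for j
  have ne: "Suc i mod K \<noteq> i" and lt: "Suc i mod K < K"
    using K \<open>i < K\<close> by (auto simp: mod_Suc)
  have "(\<Sum>j<K. cycle_entry K s i j * w j) =
      (\<Sum>j<K. (if j = i then s i * w i else 0) + (if j = Suc i mod K then w (Suc i mod K) else 0))"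
    using ne by (intro sum.cong) (auto simp: cycle_entry_def)
  also have "\<dots> = s i * w i + w (Suc i mod K)"
    using \<open>i < K\<close> lt by (simp add: sum.distrib)
  \<comment> \<open>In the last row column 0 stands in for column \<open>K\<close>; the twist by the
    total product makes \<open>w\<close> periodic there.\<close>
  also have "w (Suc i mod K) = w (Suc i)"
  proof (cases "Suc i = K")
    case True
    have "w K = (\<Prod>l<K. s l) * ((\<Prod>l<K. s l) * cas 0)"
      using twist[of 0] by (simp add: w_def mult.commute)
    also have "\<dots> = w 0"
      using sign_prod_square[of K] by (simp add: w_def mult.assoc[symmetric])
    finally show ?thesis using True by simp
  qed (use \<open>i < K\<close> in simp)
  also have "s i * w i + w (Suc i) = (\<Prod>l<Suc i. s l) * (cas (\<theta> * real i) + cas (\<theta> * real (Suc i)))"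
    by (simp add: w_def algebra_simps)
  also have "cas (\<theta> * real i) + cas (\<theta> * real (Suc i)) = 2 * cos (\<theta> / 2) * cas (\<theta> * (real i + 1 / 2))"
    using cas_add_cas[of "\<theta> * (real i + 1 / 2)" "\<theta> / 2"] by (simp add: algebra_simps)
  finally show ?thesis by (simp add: w_def mult_ac)
qed

text \<open>Dual computation: column \<open>j\<close> meets the rows \<open>j\<close> and
  \<open>j - 1\<close>, whose half-integer samples average back to position
  \<open>j\<close>.\<close>

lemma cycle_left_singular_vector:
  assumes "j < K"
  shows "(\<Sum>i<K. cycle_entry K s i j * ((\<Prod>l<Suc i. s l) * cas (\<theta> * (real i + 1 / 2)))) =
    (\<Prod>l<j. s l) * cas (\<theta> * real j) * (2 * cos (\<theta> / 2))"
proof -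
  define y where "y i = (\<Prod>l<Suc i. s l) * cas (\<theta> * (real i + 1 / 2))" for i
  \<comment> \<open>The cyclic predecessor of \<open>j\<close>; for \<open>j = 0\<close> the twist
    again accounts for the wrap-around.\<close>
  define p where "p = (if j = 0 then K - 1 else j - 1)"
  have p: "p \<noteq> j" "p < K" and pred: "\<And>i. i < K \<Longrightarrow> j = Suc i mod K \<longleftrightarrow> i = p"
    using K \<open>j < K\<close> by (auto simp: p_def mod_Suc)
  have "(\<Sum>i<K. cycle_entry K s i j * y i) =
      (\<Sum>i<K. (if i = j then s j * y j else 0) + (if i = p then y p else 0))"
    using p pred by (intro sum.cong) (auto simp: cycle_entry_def)
  also have "\<dots> = s j * y j + y p"
    using \<open>j < K\<close> p by (simp add: sum.distrib)
  also have "y p = (\<Prod>l<j. s l) * cas (\<theta> * real j - \<theta> / 2)"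
  proof (cases "j = 0")
    case True
    have "cas (\<theta> * (real p + 1 / 2)) = cas (- (\<theta> / 2) + real K * \<theta>)"
      using K True by (intro arg_cong[where f = cas]) (simp add: p_def of_nat_diff algebra_simps)
    then have "y p = (\<Prod>l<K. s l) * ((\<Prod>l<K. s l) * cas (- (\<theta> / 2)))"
      using K True unfolding twist by (simp add: y_def p_def)
    then show ?thesis
      using sign_prod_square[of K] True by (simp add: mult.assoc[symmetric])
  next
    case False
    then have "\<theta> * (real p + 1 / 2) = \<theta> * real j - \<theta> / 2" "Suc p = j"
      by (auto simp: p_def of_nat_diff algebra_simps)
    then show ?thesis by (simp only: y_def)
  qed
  also have "s j * y j = (s j * s j) * (\<Prod>l<j. s l) * cas (\<theta> * real j + \<theta> / 2)"
    by (simp add: y_def algebra_simps)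
  also have "\<dots> = (\<Prod>l<j. s l) * cas (\<theta> * real j + \<theta> / 2)"
    using s[OF \<open>j < K\<close>] by simp
  finally show ?thesis
    using cas_add_cas[of "\<theta> * real j" "\<theta> / 2"]
    by (simp add: y_def distrib_left[symmetric] mult_ac)
qed

end

text \<open>The coordinates of \<open>p\<close> are the position on a cycle, the cycle and the
  offset inside a block. Rotating the cycle number by an amount that depends on the position is what
  conceals which blocks form one cycle.\<close>

definition shift_index :: "nat \<Rightarrow> nat \<Rightarrow> (nat \<Rightarrow> nat) \<Rightarrow> nat \<Rightarrow> nat \<times> nat \<times> nat" where
  "shift_index M k x p = (let i = p div k div M in (i, (p div k mod M + x i) mod M, p mod k))"

text \<open>A rotation modulo \<open>M\<close> can be cancelled, which gives injectivity; equal
  cardinalities give the rest.\<close>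

lemma bij_betw_shift_index:
  "bij_betw (shift_index M k x) {..<K * M * k} ({..<K} \<times> {..<M} \<times> {..<k})"
proof -
  have inj: "inj_on (shift_index M k x) {..<K * M * k}"
  proof (rule inj_onI)
    fix p q assume p: "p \<in> {..<K * M * k}" and "q \<in> {..<K * M * k}"
      and eq: "shift_index M k x p = shift_index M k x q"
    then have "M > 0" by (cases M) auto
    let ?i = "p div k div M"
    from eq have 1: "p div k div M = q div k div M" "p mod k = q mod k"
      and "[p div k mod M + x ?i = q div k mod M + x ?i] (mod M)"
      by (auto simp: shift_index_def Let_def cong_def)
    then have "p div k mod M = q div k mod M"
      using cong_add_rcancel_nat[of "p div k mod M"] by (simp add: cong_def)
    with 1 have "p div k = q div k" by (metis div_mult_mod_eq)
    with 1 show "p = q" by (metis div_mult_mod_eq)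
  qed
  moreover have "shift_index M k x ` {..<K * M * k} = {..<K} \<times> {..<M} \<times> {..<k}"
  proof (rule card_subset_eq)
    show "shift_index M k x ` {..<K * M * k} \<subseteq> {..<K} \<times> {..<M} \<times> {..<k}"
    proof (clarsimp simp: shift_index_def Let_def)
      fix p assume p: "p < K * M * k"
      then have "M > 0" "k > 0" by (cases M; cases k; simp)+
      with p show "p div k div M < K \<and> (p div k mod M + x (p div k div M)) mod M < M \<and> p mod k < k"
        by (simp add: less_mult_imp_div_less)
    qed
    show "card (shift_index M k x ` {..<K * M * k}) = card ({..<K} \<times> {..<M} \<times> {..<k})"
      using card_image[OF inj] by simp
  qed simp
  ultimately show ?thesis by (simp add: bij_betw_def)
qed

lemma sum_times3:
  "(\<Sum>c\<in>A \<times> B \<times> C. f c) = (\<Sum>i\<in>A. \<Sum>a\<in>B. \<Sum>t\<in>C. f (i, a, t))"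
  by (simp add: sum.cartesian_product split_beta)

subsection \<open>The hidden instance\<close>

definition hartley :: "nat \<Rightarrow> nat \<Rightarrow> nat \<Rightarrow> real" where
  "hartley k t u = cas (2 * pi * real t / real k * real u)"

lemma hartley_commute: "hartley k t u = hartley k u t"
  by (simp add: hartley_def mult_ac)

text \<open>The direct sum of the cycles, tensored with the Hartley matrix. As \<open>cas\<close> is
  bounded by \<open>sqrt 2\<close>, the division by \<open>sqrt 2\<close> keeps all entries in
  \<open>[-1, 1]\<close>.\<close>

definition block_entry ::
  "nat \<Rightarrow> nat \<Rightarrow> (nat \<times> nat \<Rightarrow> real) \<Rightarrow> nat \<times> nat \<times> nat \<Rightarrow> nat \<times> nat \<times> nat \<Rightarrow> real" where
  "block_entry K k s = (\<lambda>(i, a, t) (j, b, u).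
     if a = b then cycle_entry K (\<lambda>l. s (l, a)) i j * hartley k t u / sqrt 2 else 0)"

text \<open>\<open>M\<close> counts the cycles and \<open>k\<close> is the side of a block; writing
  the cycle length as \<open>2 * L + 1\<close> keeps it odd.\<close>

locale hidden_cycles =
  fixes n L M k :: nat
  assumes L: "L \<ge> 1" and M: "M \<ge> 1" and k: "k \<ge> 1" and fits: "(2 * L + 1) * M * k \<le> n"
begin

definition K :: nat where "K = 2 * L + 1"

definition h :: real where "h = pi / (2 * real K)"

definition hidden_matrix :: "(nat \<Rightarrow> nat) \<Rightarrow> (nat \<Rightarrow> nat) \<Rightarrow> (nat \<times> nat \<Rightarrow> real) \<Rightarrow> real mat" where
  "hidden_matrix x y s = Matrix.mat n n (\<lambda>(p, q). if p < K * M * k \<and> q < K * M * k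
     then block_entry K k s (shift_index M k x p) (shift_index M k y q) else 0)"

text \<open>The parity of \<tau> encodes the common product; 0 belongs to the larger norm and 1 to
  the smaller one. Extensional functions make the set finite and let sign flips be
  involutions.\<close>

definition signings :: "nat \<Rightarrow> (nat \<times> nat \<Rightarrow> real) set" where
  "signings \<tau> = {s \<in> {..<K} \<times> {..<M} \<rightarrow>\<^sub>E {1, -1}. \<forall>a<M. (\<Prod>i<K. s (i, a)) = (-1) ^ \<tau>}"

lemma K: "K \<ge> 3" "real K * (2 * h) = pi" and h: "0 < h" "h \<le> pi / 6"
  using L by (auto simp: K_def h_def field_simps)

lemma sum_hartley_columns:
  assumes "u < k" "v < k"
  shows "(\<Sum>t<k. hartley k t u * hartley k t v) = (if u = v then real k else 0)"
  unfolding hartley_commute[of k _ u] hartley_commute[of k _ v] unfolding hartley_def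
  by (rule sum_hartley[OF assms])

text \<open>The half angle \<open>\<theta>\<^sub>j / 2\<close> is \<open>(2 j - 2 L + \<tau>) h\<close>; for \<open>j < K\<close> and
  \<open>\<tau> \<in> {0, 1}\<close> it lies in \<open>[-\<pi>/2, \<pi>/2]\<close>, so its cosine is nonnegative.\<close>

definition \<theta> :: "nat \<Rightarrow> nat \<Rightarrow> real" where
  "\<theta> \<tau> j = 2 * (real \<tau> - 2 * real L + 2 * real j) * h"

text \<open>\<open>K * \<theta> \<tau> j\<close> is an integer multiple of \<pi> with the parity of
  \<tau>, so the frequency satisfies the boundary condition for product
  \<open>(-1) ^ \<tau>\<close>.\<close>

lemma cas_theta_twist: "cas (x + real K * \<theta> \<tau> j) = (-1) ^ \<tau> * cas x"
proof -
  have "real K * \<theta> \<tau> j = of_int (int \<tau> - 2 * int L + 2 * int j) * pi"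
    unfolding K(2)[symmetric] by (simp add: \<theta>_def algebra_simps)
  then show ?thesis by (simp only: cas_add_int_pi) simp
qed

lemma sum_cas_theta:
  assumes "i < K" "j < K"
  shows "(\<Sum>l<K. cas (\<theta> \<tau> i * real l) * cas (\<theta> \<tau> j * real l)) = (if i = j then real K else 0)"
proof -
  have \<theta>: "\<theta> \<tau> i = (real \<tau> - 2 * real L + 2 * real i) * pi / real K" for i
    using K by (simp add: \<theta>_def h_def field_simps)
  have "\<not> int K dvd int i - int j" if "i \<noteq> j"
    using zdvd_not_zless[of "int i - int j" "int K"] zdvd_not_zless[of "int j - int i" "int K"] that assms
    by (cases i j rule: linorder_cases) (auto simp: dvd_diff_commute)
  then have "int K dvd int i - int j \<longleftrightarrow> i = j" by auto
  then show ?thesis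
    using sum_cas_mult_cas[of K "\<theta> \<tau> i" "\<theta> \<tau> j" "int i - int j" "int \<tau> - 2 * int L + int i + int j"] K
    by (simp add: \<theta> field_simps)
qed

text \<open>The singular system is the tensor product of that of a cycle and that of the Hartley
  matrix, so each value occurs \<open>M * k\<close> times and only a sum of cosines along the cycle
  remains.\<close>

lemma schatten1_hidden_matrix:
  assumes s: "s \<in> signings \<tau>" and "\<tau> \<le> 1"
  shows "schatten1 (hidden_matrix x y s) = real M * real k * sqrt (real k / 2) * (2 * cos (real \<tau> * h) / sin h)"
proof -
  define I where "I = {..<K} \<times> {..<M} \<times> {..<k}"
  define g where "g a i = (\<Prod>l<i. s (l, a))" for a i
  \<comment> \<open>Right vectors are gauged waves supported on one offset \<open>u\<close> of one
    cycle; left vectors carry the normalised Hartley column \<open>u\<close>. The Hartley matrix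
    over \<open>sqrt 2\<close> has all singular values \<open>sqrt (k / 2)\<close>, the extra factor
    in \<sigma>.\<close>
  define V where "V = (\<lambda>(i, a, t) (j, b, u :: nat). if a = b \<and> t = u then g a i * cas (\<theta> \<tau> j * real i) else 0)"
  define U where "U = (\<lambda>(i, a, t) (j, b :: nat, u). if a = b
    then g a (Suc i) * cas (\<theta> \<tau> j * (real i + 1 / 2)) * hartley k t u / sqrt (real k) else 0)"
  define \<sigma> where "\<sigma> = (\<lambda>(j, b :: nat, u :: nat). 2 * cos (\<theta> \<tau> j / 2) * sqrt (real k / 2))"
  have sq: "s (i, a) * s (i, a) = 1" if "i < K" "a < M" for i a
  proof -
    have "s (i, a) \<in> {1, -1}"
      using s that by (auto simp: signings_def simp del: insert_iff dest!: PiE_mem[where x = "(i, a)"])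
    then show ?thesis by auto
  qed
  have twist: "cas (x + real K * \<theta> \<tau> j) = (\<Prod>i<K. s (i, a)) * cas x" if "a < M" for x j a
    using s that by (simp add: cas_theta_twist signings_def)
  have gg: "g a i * g a i = 1" if "i < K" "a < M" for a i
    using sq that by (simp add: g_def prod.distrib[symmetric])
  have k0: "sqrt (real k) > 0" using k by simp
  have V_sum: "(\<Sum>c\<in>I. f c * V c (j, b, u)) = (\<Sum>i<K. f (i, b, u) * (g b i * cas (\<theta> \<tau> j * real i)))"
    if "b < M" "u < k" for f j b u
  proof -
    have "(\<Sum>c\<in>I. f c * V c (j, b, u)) = (\<Sum>i<K. \<Sum>a<M. \<Sum>t<k. if a = b then if t = u then
        f (i, b, u) * (g b i * cas (\<theta> \<tau> j * real i)) else 0 else 0)"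
      unfolding I_def sum_times3 by (intro sum.cong) (auto simp: V_def)
    also have "\<dots> = (\<Sum>i<K. \<Sum>a<M. if a = b then f (i, b, u) * (g b i * cas (\<theta> \<tau> j * real i)) else 0)"
      using that by (intro sum.cong refl) simp
    finally show ?thesis using that by simp
  qed
  have orth: "(\<Sum>c\<in>I. V c p * V c q) = (if p = q then real K else 0)" if pq: "p \<in> I" "q \<in> I" for p q
  proof -
    obtain i a t j b u where p: "p = (i, a, t)" and q: "q = (j, b, u)" by (metis prod_cases3)
    have *: "i < K" "a < M" "t < k" "j < K" "b < M" "u < k" using pq by (auto simp: I_def p q)
    have "(\<Sum>c\<in>I. V c p * V c q) =
        (\<Sum>l<K. if a = b \<and> t = u then (g b l * g b l) * (cas (\<theta> \<tau> i * real l) * cas (\<theta> \<tau> j * real l)) else 0)"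
      unfolding q V_sum[OF *(5,6)] by (intro sum.cong refl) (auto simp: V_def p)
    also have "\<dots> = (if a = b \<and> t = u then \<Sum>l<K. cas (\<theta> \<tau> i * real l) * cas (\<theta> \<tau> j * real l) else 0)"
      using * by (cases "a = b \<and> t = u") (auto simp: gg intro!: sum.neutral sum.cong)
    also have "\<dots> = (if p = q then real K else 0)"
      unfolding sum_cas_theta[OF *(1,4)] by (auto simp: p q)
    finally show ?thesis .
  qed
  have FV: "(\<Sum>c\<in>I. block_entry K k s r c * V c q) = U r q * \<sigma> q" if rq: "r \<in> I" "q \<in> I" for r q
  proof -
    obtain i a t j b u where r: "r = (i, a, t)" and q: "q = (j, b, u)" by (metis prod_cases3)
    have *: "i < K" "a < M" "t < k" "j < K" "b < M" "u < k" using rq by (auto simp: I_def r q)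
    have "(\<Sum>c\<in>I. block_entry K k s r c * V c q) = (if a = b then hartley k t u / sqrt 2 *
        (\<Sum>l<K. cycle_entry K (\<lambda>l. s (l, a)) i l * (g a l * cas (\<theta> \<tau> j * real l))) else 0)"
      unfolding q V_sum[OF *(5,6)] sum_distrib_left by (auto simp: r block_entry_def mult_ac intro!: sum.cong)
    also have "\<dots> = (if a = b then hartley k t u / sqrt 2 *
        (g a (Suc i) * cas (\<theta> \<tau> j * (real i + 1 / 2)) * (2 * cos (\<theta> \<tau> j / 2))) else 0)"
      unfolding g_def using K * sq twist by (subst cycle_right_singular_vector) auto
    also have "\<dots> = U r q * \<sigma> q"
      using k0 by (simp add: U_def \<sigma>_def r q real_sqrt_divide)
    finally show ?thesis .
  qed
  have FU: "(\<Sum>r\<in>I. block_entry K k s r c * U r q) = V c q * \<sigma> q" if cq: "c \<in> I" "q \<in> I" for c q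
  proof -
    obtain i a t j b u where c: "c = (i, a, t)" and q: "q = (j, b, u)" by (metis prod_cases3)
    have *: "i < K" "a < M" "t < k" "j < K" "b < M" "u < k" using cq by (auto simp: I_def c q)
    let ?X = "\<lambda>l. cycle_entry K (\<lambda>l. s (l, a)) l i * (g a (Suc l) * cas (\<theta> \<tau> j * (real l + 1 / 2)))"
    have "(\<Sum>r\<in>I. block_entry K k s r c * U r q) = (\<Sum>l<K. \<Sum>a'<M. \<Sum>t'<k. if a' = a then if a = b then
        ?X l * (hartley k t' t * hartley k t' u) / (sqrt 2 * sqrt (real k)) else 0 else 0)"
      unfolding I_def sum_times3 by (intro sum.cong refl) (auto simp: block_entry_def U_def c q mult_ac)
    also have "\<dots> = (\<Sum>l<K. \<Sum>a'<M. if a' = a then if a = b then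
        ?X l * (\<Sum>t'<k. hartley k t' t * hartley k t' u) / (sqrt 2 * sqrt (real k)) else 0 else 0)"
      by (intro sum.cong refl) (simp add: sum_distrib_left sum_divide_distrib)
    also have "\<dots> = (\<Sum>l<K. if a = b then
        ?X l * (\<Sum>t'<k. hartley k t' t * hartley k t' u) / (sqrt 2 * sqrt (real k)) else 0)"
      using * by simp
    also have "\<dots> = (if a = b then (\<Sum>l<K. ?X l) *
        (\<Sum>t'<k. hartley k t' t * hartley k t' u) / (sqrt 2 * sqrt (real k)) else 0)"
      by (simp add: sum_distrib_right sum_divide_distrib)
    also have "(\<Sum>l<K. ?X l) = g a i * cas (\<theta> \<tau> j * real i) * (2 * cos (\<theta> \<tau> j / 2))"
      unfolding g_def using K * sq twist by (subst cycle_left_singular_vector) auto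
    also have "(\<Sum>t'<k. hartley k t' t * hartley k t' u) = (if t = u then sqrt (real k) * sqrt (real k) else 0)"
      using sum_hartley_columns * by simp
    finally show ?thesis
      using k0 by (auto simp: V_def \<sigma>_def c q real_sqrt_divide field_simps simp del: real_sqrt_mult_self)
  qed
  have bij: "bij_betw (shift_index M k z) {..<K * M * k} I" for z
    unfolding I_def by (rule bij_betw_shift_index)
  have half_angle: "\<theta> \<tau> j / 2 = (real \<tau> - 2 * real L + 2 * real j) * h" for j
    by (simp add: \<theta>_def)
  have "K * M * k \<le> n" "real K > 0" using fits by (simp_all add: K_def)
  then have "schatten1 (hidden_matrix x y s) = (\<Sum>j\<in>I. \<bar>\<sigma> j\<bar>)"
    unfolding hidden_matrix_def
    by (intro schatten1_eq_sum_of_indexed_singular_system[OF _ bij bij orth _ FV FU])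
  also have "\<dots> = (\<Sum>j<K. real M * real k * sqrt (real k / 2) * 2 * cos (\<theta> \<tau> j / 2))"
    unfolding I_def sum_times3
  proof (intro sum.cong refl)
    fix j assume "j \<in> {..<K}"
    then have "real j \<le> 2 * real L" by (simp add: K_def)
    have "\<bar>\<theta> \<tau> j / 2\<bar> = \<bar>real \<tau> - 2 * real L + 2 * real j\<bar> * h"
      unfolding half_angle using h by (simp add: abs_mult)
    also have "\<dots> \<le> real K * h"
      using h \<open>real j \<le> 2 * real L\<close> \<open>\<tau> \<le> 1\<close> by (intro mult_right_mono) (auto simp: K_def)
    also have "\<dots> = pi / 2" using K by simp
    finally have "cos (\<theta> \<tau> j / 2) \<ge> 0" by (intro cos_ge_zero) auto
    then show "(\<Sum>a<M. \<Sum>t<k. \<bar>\<sigma> (j, a, t)\<bar>) = real M * real k * sqrt (real k / 2) * 2 * cos (\<theta> \<tau> j / 2)"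
      by (simp add: \<sigma>_def abs_mult)
  qed
  also have "\<dots> = real M * real k * sqrt (real k / 2) * 2 * (\<Sum>j<K. cos ((real \<tau> - 2 * real L) * h + 2 * real j * h))"
    unfolding sum_distrib_left half_angle by (simp add: distrib_right)
  also have "(\<Sum>j<K. cos ((real \<tau> - 2 * real L) * h + 2 * real j * h)) = cos (real \<tau> * h) / sin h"
  proof -
    have Kh: "(2 * real L + 1) * h = pi / 2"
      using K(2) unfolding K_def by (simp add: mult_ac add.commute)
    \<comment> \<open>The end points of the telescoped sum lie at \<open>\<tau> * h\<close> plus and
      minus a quarter period, so both sines become \<open>cos (\<tau> * h)\<close> up to
      sign.\<close>
    have "(real \<tau> - 2 * real L) * h + (2 * real K - 1) * h = real \<tau> * h + pi / 2"
      "(real \<tau> - 2 * real L) * h - h = real \<tau> * h - pi / 2"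
      unfolding Kh[symmetric] by (simp_all add: K_def algebra_simps)
    then have "2 * sin h * (\<Sum>j<K. cos ((real \<tau> - 2 * real L) * h + 2 * real j * h)) = 2 * cos (real \<tau> * h)"
      unfolding sum_cos_arith_progression by (simp add: sin_add sin_diff)
    moreover have "sin h > 0" using h by (intro sin_gt_zero) auto
    ultimately show ?thesis by (simp add: field_simps)
  qed
  finally show ?thesis by simp
qed

lemma hidden_matrix_in_inputs:
  assumes "s \<in> signings \<tau>"
  shows "hidden_matrix x y s \<in> inputs n"
proof -
  have "(2 * L + 1) * M * k > 0" using M k by simp
  then have "n > 0" using fits by linarith
  have car: "hidden_matrix x y s \<in> carrier_mat n n" by (simp add: hidden_matrix_def)
  have entry: "\<bar>block_entry K k s r c\<bar> \<le> 1" if "r \<in> {..<K} \<times> {..<M} \<times> {..<k}" for r c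
  proof -
    obtain i a t j b u where r: "r = (i, a, t)" and c: "c = (j, b, u)" by (metis prod_cases3)
    have "s (i, a) \<in> {1, -1}"
      using assms that by (auto simp: r signings_def simp del: insert_iff dest!: PiE_mem[where x = "(i, a)"])
    then have "\<bar>cycle_entry K (\<lambda>l. s (l, a)) i j\<bar> \<le> 1" by (auto simp: cycle_entry_def)
    then have "\<bar>cycle_entry K (\<lambda>l. s (l, a)) i j\<bar> * (\<bar>hartley k t u\<bar> / sqrt 2) \<le> 1 * 1"
      using abs_cas_le by (intro mult_mono) (auto simp: hartley_def)
    then show ?thesis by (cases "a = b") (simp_all add: block_entry_def r c abs_mult)
  qed
  have "\<bar>v\<bar> \<le> 1" if "v \<in> elements_mat (hidden_matrix x y s)" for v
  proof -
    from elements_matD[OF that] obtain p q where "p < n" "q < n" "v = hidden_matrix x y s $$ (p, q)"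
      by (auto simp: hidden_matrix_def)
    then show ?thesis
      using entry[OF bij_betw_apply[OF bij_betw_shift_index[of M k x K], of p]]
      by (auto simp: hidden_matrix_def simp del: mem_Times_iff)
  qed
  moreover have "finite (elements_mat (hidden_matrix x y s))" by (simp add: elements_mat_def)
  \<comment> \<open>A witness that the set under \<open>Max\<close> is nonempty.\<close>
  moreover have "hidden_matrix x y s $$ (0, 0) \<in> elements_mat (hidden_matrix x y s)"
    using car \<open>n > 0\<close> by blast
  ultimately have "max_norm (hidden_matrix x y s) \<le> 1"
    unfolding max_norm_def by (subst Max_le_iff) auto
  with car show ?thesis by (simp add: inputs_def)
qed

end

subsection \<open>Indistinguishability\<close>

text \<open>Linearity of expectation: a bound valid for each deterministic sampler passes to the
  random one, as in Yao's principle.\<close>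

lemma (in prob_space) sum_prob_le:
  assumes "finite C" and X: "\<And>c. c \<in> C \<Longrightarrow> X c \<in> events"
    and bound: "\<And>a. a \<in> space M \<Longrightarrow> (\<Sum>c\<in>C. of_bool (a \<in> X c)) \<le> (b :: real)"
  shows "(\<Sum>c\<in>C. prob (X c)) \<le> b"
proof -
  have int: "integrable M (indicator (X c) :: _ \<Rightarrow> real)" if "c \<in> C" for c
    using X[OF that] by (simp add: emeasure_eq_measure)
  have "(\<Sum>c\<in>C. prob (X c)) = (\<Sum>c\<in>C. expectation (indicator (X c)))"
    using X by (intro sum.cong) (auto simp: sets.Int_space_eq2)
  also have "\<dots> = expectation (\<lambda>a. \<Sum>c\<in>C. indicator (X c) a)"
    using int by simp
  also have "\<dots> \<le> b"
  proof (intro integral_le_const AE_I2)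
    show "(\<Sum>c\<in>C. indicator (X c) a) \<le> b" if "a \<in> space M" for a
      using bound[OF that] by (simp add: indicator_def)
  qed (use int in simp)
  finally show ?thesis .
qed

lemma run_cong:
  assumes "\<And>p. p \<in> fst a \<Longrightarrow> A $$ p = B $$ p"
  shows "run a A = run a B"
proof -
  have "restrict (\<lambda>p. A $$ p) (fst a) = restrict (\<lambda>p. B $$ p) (fst a)"
    using assms by (intro restrict_ext) auto
  then show ?thesis by (simp add: run_def split_beta)
qed

text \<open>The space of samplers may be infinite, but their query sets are subsets of one finite
  grid, so the maximum is over a finite set.\<close>

lemma num_queries_ge:
  assumes alg: "nonadaptive_algorithm n Alg" and "a \<in> space Alg"
  shows "card (fst a) \<le> num_queries Alg"
proof -
  have "fst b \<in> Pow ({..<n} \<times> {..<n})" if "b \<in> space Alg" for b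
    using alg that by (auto simp: nonadaptive_algorithm_def)
  then have "fst ` space Alg \<subseteq> Pow ({..<n} \<times> {..<n})" by blast
  then have "finite (fst ` space Alg)" by (rule finite_subset) simp
  then have "finite ((\<lambda>b. card (fst b)) ` space Alg)"
    by (simp add: image_image[symmetric, of card fst])
  then show ?thesis
    unfolding num_queries_def using assms(2) by (intro Max_ge) auto
qed

section \<open>Counting the shifts that expose a whole cycle\<close>

context hidden_cycles
begin

definition shifts :: "(nat \<Rightarrow> nat \<times> nat) set" where
  "shifts = {..<K} \<rightarrow>\<^sub>E {..<M} \<times> {..<M}"

definition shifted_matrix :: "(nat \<Rightarrow> nat \<times> nat) \<Rightarrow> (nat \<times> nat \<Rightarrow> real) \<Rightarrow> real mat" where
  "shifted_matrix z = hidden_matrix (fst \<circ> z) (snd \<circ> z)"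

text \<open>The queries \<open>S\<close> see the sign at position \<open>i\<close> of the cycle \<open>a\<close>.\<close>

definition exposed :: "(nat \<times> nat) set \<Rightarrow> (nat \<Rightarrow> nat \<times> nat) \<Rightarrow> nat \<Rightarrow> nat \<Rightarrow> bool" where
  "exposed S z a i \<longleftrightarrow> (\<exists>(p, q)\<in>S. \<exists>t u. p < K * M * k \<and> q < K * M * k \<and>
     shift_index M k (fst \<circ> z) p = (i, a, t) \<and> shift_index M k (snd \<circ> z) q = (i, a, u))"

text \<open>Only for these shifts can the queries cover every sign of some cycle, and so reveal the
  common product.\<close>

definition bad_shifts :: "(nat \<times> nat) set \<Rightarrow> (nat \<Rightarrow> nat \<times> nat) set" where
  "bad_shifts S = {z \<in> shifts. \<exists>a<M. \<forall>i<K. exposed S z a i}"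

lemma card_shifts: "card shifts = (M\<^sup>2) ^ K"
  by (simp add: shifts_def card_PiE power2_eq_square)

text \<open>For a fixed cycle \<open>a\<close>, a query that exposes position \<open>i\<close>
  determines \<open>z i\<close>, so each \<open>z i\<close> has at most \<open>card S\<close>
  values; the factor \<open>M\<close> is the union bound over cycles.\<close>

lemma card_bad_shifts_le:
  assumes "finite S"
  shows "card (bad_shifts S) \<le> M * card S ^ K"
proof -
  \<comment> \<open>The unique rotation below \<open>M\<close> that carries the block of
    \<open>p\<close> to cycle \<open>a\<close>.\<close>
  define g where "g a p = (a + (M - p div k mod M)) mod M" for a p :: nat
  have g: "w = g a p" if "w < M" "(p div k mod M + w) mod M = a" for w a p
  proof -
    have "p div k mod M < M" using M by simp
    then have "(p div k mod M + w) + (M - p div k mod M) = w + M" by linarith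
    then have "g a p = (w + M) mod M"
      using mod_add_left_eq[of "p div k mod M + w" M "M - p div k mod M"]
      by (simp only: g_def that(2))
    then show ?thesis using that(1) by simp
  qed
  define T where "T a = (\<lambda>(p, q). (g a p, g a q)) ` S" for a
  have "bad_shifts S \<subseteq> (\<Union>a<M. {..<K} \<rightarrow>\<^sub>E T a)"
  proof
    fix z assume "z \<in> bad_shifts S"
    then obtain a where z: "z \<in> shifts" and "a < M" and a: "\<And>i. i < K \<Longrightarrow> exposed S z a i"
      by (auto simp: bad_shifts_def)
    have "z i \<in> T a" if "i < K" for i
    proof -
      have zi: "fst (z i) < M" "snd (z i) < M"
        using PiE_mem[of z "{..<K}" "\<lambda>_. {..<M} \<times> {..<M}" i] z that
        by (simp_all add: shifts_def mem_Times_iff)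
      from a[OF that] obtain p q where pq: "(p, q) \<in> S"
        "(p div k mod M + fst (z i)) mod M = a" "(q div k mod M + snd (z i)) mod M = a"
        by (auto simp: exposed_def shift_index_def Let_def)
      have "z i = (g a p, g a q)"
        using g[OF zi(1) pq(2)] g[OF zi(2) pq(3)] by (simp only: prod_eq_iff fst_conv snd_conv)
      with pq(1) show ?thesis unfolding T_def by (intro image_eqI[of _ _ "(p, q)"]) simp_all
    qed
    then have "z \<in> {..<K} \<rightarrow>\<^sub>E T a"
      using z by (simp add: shifts_def PiE_iff)
    then show "z \<in> (\<Union>a<M. {..<K} \<rightarrow>\<^sub>E T a)"
      using \<open>a < M\<close> by blast
  qed
  then have "card (bad_shifts S) \<le> card (\<Union>a<M. {..<K} \<rightarrow>\<^sub>E T a)"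
    using assms by (intro card_mono finite_UN_I finite_PiE) (simp_all add: T_def)
  also have "\<dots> \<le> (\<Sum>a<M. card ({..<K} \<rightarrow>\<^sub>E T a))"
    by (rule card_UN_le) simp
  also have "\<dots> = (\<Sum>a<M. card (T a) ^ K)" by (simp add: card_PiE)
  also have "\<dots> \<le> (\<Sum>a<M. card S ^ K)"
    using assms by (intro sum_mono power_mono) (simp_all add: T_def card_image_le)
  finally show ?thesis by simp
qed

text \<open>Each position of a given cycle is exposed by at most half of its
  \<open>M\<^sup>2\<close> rotation pairs, so the bad fraction is at most \<open>M / 2 ^ K\<close>,
  below one half.\<close>

lemma few_bad_shifts:
  assumes "finite S" "2 * card S \<le> M\<^sup>2" "2 * M < 2 ^ K"
  shows "2 * card (bad_shifts S) < card shifts"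
proof -
  have "2 ^ K * card (bad_shifts S) \<le> 2 ^ K * (M * card S ^ K)"
    using card_bad_shifts_le[OF assms(1)] by (rule mult_le_mono2)
  also have "\<dots> = M * (2 * card S) ^ K" by (simp add: power_mult_distrib)
  also have "\<dots> \<le> M * card shifts"
    unfolding card_shifts using assms(2) by (intro mult_le_mono2 power_mono) auto
  finally have *: "2 ^ K * card (bad_shifts S) \<le> M * card shifts" .
  show ?thesis
  proof (cases "card (bad_shifts S) = 0")
    case True
    then show ?thesis using M by (simp add: card_shifts)
  next
    case False
    then have "2 * M * card (bad_shifts S) < 2 ^ K * card (bad_shifts S)"
      using assms(3) by (intro mult_strict_right_mono) auto
    then have "M * (2 * card (bad_shifts S)) < 2 ^ K * card (bad_shifts S)"
      by (simp only: mult_ac)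
    then have "M * (2 * card (bad_shifts S)) < M * card shifts"
      using * by (rule less_le_trans)
    then show ?thesis by simp
  qed
qed

section \<open>Pairing signings by flipping one sign per cycle\<close>

lemma finite_shifts: "finite shifts"
  by (auto simp: shifts_def intro!: finite_PiE)

lemma finite_signings: "finite (signings \<tau>)"
proof (rule finite_subset)
  show "signings \<tau> \<subseteq> {..<K} \<times> {..<M} \<rightarrow>\<^sub>E {1, -1}" by (auto simp: signings_def)
qed (auto intro!: finite_PiE)

lemma signings_disjoint: "signings 0 \<inter> signings 1 = {}"
  using M by (auto simp: signings_def)

lemma signings_0_nonempty: "signings 0 \<noteq> {}"
proof -
  have "restrict (\<lambda>_. 1) ({..<K} \<times> {..<M}) \<in> signings 0"
    by (auto simp: signings_def)
  then show ?thesis by blast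
qed

definition flip :: "(nat \<Rightarrow> nat) \<Rightarrow> (nat \<times> nat \<Rightarrow> real) \<Rightarrow> nat \<times> nat \<Rightarrow> real" where
  "flip f s = restrict (\<lambda>(i, a). if i = f a then - s (i, a) else s (i, a)) ({..<K} \<times> {..<M})"

text \<open>Exactly one factor of each cycle changes sign, hence so does each product.\<close>

lemma flip_in_signings:
  assumes f: "\<And>a. a < M \<Longrightarrow> f a < K" and s: "s \<in> signings \<tau>"
  shows "flip f s \<in> signings (1 + \<tau>)"
proof -
  have s_mem: "s (i, a) \<in> {1, -1}" if "i < K" "a < M" for i a
    using s that by (auto simp: signings_def simp del: insert_iff dest!: PiE_mem[where x = "(i, a)"])
  have "(\<Prod>i<K. flip f s (i, a)) = (-1) ^ (1 + \<tau>)" if "a < M" for a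
  proof -
    have "(\<Prod>i<K. flip f s (i, a)) = (\<Prod>i<K. s (i, a) * (if i = f a then -1 else 1))"
      using that by (intro prod.cong) (auto simp: flip_def)
    also have "\<dots> = (-1) ^ (1 + \<tau>)"
      using f[OF that] s that by (simp add: prod.distrib signings_def)
    finally show ?thesis .
  qed
  moreover have "flip f s \<in> {..<K} \<times> {..<M} \<rightarrow>\<^sub>E {1, -1}"
  proof (rule PiE_I)
    fix p assume "p \<in> {..<K} \<times> {..<M}"
    then obtain i a where "p = (i, a)" "i < K" "a < M" by auto
    then show "flip f s p \<in> {1, -1}" using s_mem[of i a] by (auto simp: flip_def)
  qed (auto simp: flip_def)
  ultimately show ?thesis by (simp add: signings_def)
qed

lemma bij_betw_flip:
  assumes f: "\<And>a. a < M \<Longrightarrow> f a < K"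
  shows "bij_betw (flip f) (signings 0) (signings 1)"
proof (rule bij_betw_byWitness[where f' = "flip f"])
  have inv: "flip f (flip f s) = s" if "s \<in> signings \<tau>" for s \<tau>
  proof
    fix p
    have "s p = undefined" if "p \<notin> {..<K} \<times> {..<M}"
      using \<open>s \<in> signings \<tau>\<close> that unfolding signings_def by (blast dest: PiE_arb)
    then show "flip f (flip f s) p = s p"
      by (cases p) (simp add: flip_def restrict_def)
  qed
  then show "\<forall>s\<in>signings 0. flip f (flip f s) = s" "\<forall>s\<in>signings 1. flip f (flip f s) = s" by auto
  \<comment> \<open>Only the parity of the exponent matters, so a second flip leads back.\<close>
  have "signings (1 + 1) = signings 0" by (simp add: signings_def)
  then show "flip f ` signings 0 \<subseteq> signings 1" "flip f ` signings 1 \<subseteq> signings 0"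
    using flip_in_signings[of f _ 0, OF f] flip_in_signings[of f _ 1, OF f] by (auto simp del: One_nat_def)
qed

lemma card_all_signings: "card (signings 0 \<union> signings 1) = 2 * card (signings 0)"
proof -
  have "card (signings 1) = card (signings 0)"
    by (rule bij_betw_same_card[OF bij_betw_flip[where f = "\<lambda>_. 0"], symmetric]) (use K(1) in simp)
  then show ?thesis
    using card_Un_disjoint[OF finite_signings finite_signings signings_disjoint] by linarith
qed

text \<open>The flip alters only diagonal blocks of the cycles at the positions \<open>f a\<close>,
  and none of their entries is queried.\<close>

lemma run_flip:
  assumes S: "fst alg \<subseteq> {..<n} \<times> {..<n}"
    and f: "\<And>a. a < M \<Longrightarrow> \<not> exposed (fst alg) z a (f a)"
  shows "run alg (shifted_matrix z (flip f s)) = run alg (shifted_matrix z s)"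
proof (rule run_cong)
  fix pq assume "pq \<in> fst alg"
  obtain p q where pq: "pq = (p, q)" by fastforce
  with S \<open>pq \<in> fst alg\<close> have "p < n" "q < n" by auto
  have "block_entry K k (flip f s) (shift_index M k (fst \<circ> z) p) (shift_index M k (snd \<circ> z) q) =
      block_entry K k s (shift_index M k (fst \<circ> z) p) (shift_index M k (snd \<circ> z) q)"
    if "p < K * M * k" "q < K * M * k"
  proof -
    obtain i a t j b u where r: "shift_index M k (fst \<circ> z) p = (i, a, t)"
      and c: "shift_index M k (snd \<circ> z) q = (j, b, u)" by (metis prod_cases3)
    have "i < K" "a < M"
      using bij_betw_apply[OF bij_betw_shift_index[of M k "fst \<circ> z" K], of p] that by (auto simp: r)
    moreover have "\<not> (a = b \<and> i = j \<and> i = f a)"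
      using f[OF \<open>a < M\<close>] r c that \<open>pq \<in> fst alg\<close> by (auto simp: exposed_def pq)
    ultimately show ?thesis
      unfolding r c by (auto simp: block_entry_def cycle_entry_def flip_def)
  qed
  then show "shifted_matrix z (flip f s) $$ pq = shifted_matrix z s $$ pq"
    using \<open>p < n\<close> \<open>q < n\<close> by (simp add: pq shifted_matrix_def hidden_matrix_def)
qed

text \<open>For a good shift each signing is paired with its flip: the sampler answers both alike
  and is right on exactly one. For a bad shift it is credited with all answers.\<close>

lemma correct_answers_le:
  assumes S: "fst alg \<subseteq> {..<n} \<times> {..<n}" and z: "z \<in> shifts"
  shows "(\<Sum>s\<in>signings 0 \<union> signings 1. of_bool (run alg (shifted_matrix z s) = (s \<in> signings 0)))
    \<le> card (signings 0) * (1 + of_bool (z \<in> bad_shifts (fst alg)) :: real)"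
proof (cases "z \<in> bad_shifts (fst alg)")
  case True
  have "(\<Sum>s\<in>signings 0 \<union> signings 1. of_bool (run alg (shifted_matrix z s) = (s \<in> signings 0)))
      \<le> (\<Sum>s\<in>signings 0 \<union> signings 1. 1 :: real)"
    by (intro sum_mono) auto
  also have "\<dots> = 2 * real (card (signings 0))"
    using card_all_signings by simp
  finally show ?thesis using True by simp
next
  case False
  then have "\<forall>a<M. \<exists>i<K. \<not> exposed (fst alg) z a i"
    using z by (auto simp: bad_shifts_def)
  then obtain f where f: "\<And>a. a < M \<Longrightarrow> f a < K" "\<And>a. a < M \<Longrightarrow> \<not> exposed (fst alg) z a (f a)"
    by metis
  let ?r = "\<lambda>s. run alg (shifted_matrix z s)"
  have "(\<Sum>s\<in>signings 0 \<union> signings 1. of_bool (?r s = (s \<in> signings 0))) =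
      (\<Sum>s\<in>signings 0. of_bool (?r s)) + (\<Sum>s\<in>signings 1. of_bool (\<not> ?r s) :: real)"
  proof (subst sum.union_disjoint[OF finite_signings finite_signings signings_disjoint], rule arg_cong2[where f = "(+)"])
    show "(\<Sum>s\<in>signings 1. of_bool (?r s = (s \<in> signings 0))) = (\<Sum>s\<in>signings 1. of_bool (\<not> ?r s) :: real)"
      using signings_disjoint by (intro sum.cong refl) auto
  qed (intro sum.cong refl, simp)
  also have "(\<Sum>s\<in>signings 1. of_bool (\<not> ?r s) :: real) = (\<Sum>s\<in>signings 0. of_bool (\<not> ?r s))"
  proof -
    have "bij_betw (flip f) (signings 0) (signings 1)" by (rule bij_betw_flip) (rule f(1))
    from sum.reindex_bij_betw[OF this, of "\<lambda>s. of_bool (\<not> ?r s) :: real"]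
    show ?thesis by (simp only: run_flip[OF S f(2)])
  qed
  also have "(\<Sum>s\<in>signings 0. of_bool (?r s)) + \<dots> = (\<Sum>s\<in>signings 0. 1)"
    unfolding sum.distrib[symmetric] by (intro sum.cong) auto
  finally show ?thesis using False by simp
qed

text \<open>Average over all shifts and signings. Success on every input forces an average of at
  least 3/4, whereas a sampler with few queries is right on a fraction of 1/2 plus half the fraction
  of bad shifts, which is below 3/4.\<close>

lemma many_queries_needed:
  assumes alg: "nonadaptive_algorithm n Alg" and dist: "distinguishes n \<epsilon>\<^sub>0 \<epsilon> Alg"
    and "2 * M < 2 ^ K"
    and large: "real M * real k * sqrt (real k / 2) * (2 / sin h) > \<epsilon>\<^sub>0 * real n powr 1.5"
    and small: "real M * real k * sqrt (real k / 2) * (2 * cos h / sin h)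
      < \<epsilon>\<^sub>0 * real n powr 1.5 - \<epsilon> * real n powr 1.5"
  shows "M\<^sup>2 div 2 \<le> num_queries Alg"
proof (rule ccontr)
  assume few: "\<not> M\<^sup>2 div 2 \<le> num_queries Alg"
  interpret prob_space Alg using alg by (simp add: nonadaptive_algorithm_def)
  define C where "C = shifts \<times> (signings 0 \<union> signings 1)"
  define X where "X = (\<lambda>(z, s). {a \<in> space Alg. run a (shifted_matrix z s) = (s \<in> signings 0)})"
  have inp: "shifted_matrix z s \<in> inputs n" if "s \<in> signings 0 \<union> signings 1" for z s
    using that hidden_matrix_in_inputs by (auto simp: shifted_matrix_def)
  have X_prob: "X c \<in> events \<and> prob (X c) \<ge> 3 / 4" if "c \<in> C" for c
  proof -
    obtain z s where c: "c = (z, s)" by fastforce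
    have s: "s \<in> signings 0 \<union> signings 1" using that by (simp add: C_def c)
    have runs: "{a \<in> space Alg. run a (shifted_matrix z s)} \<in> events"
      using alg inp[OF s] by (auto simp: nonadaptive_algorithm_def)
    have not_runs: "{a \<in> space Alg. \<not> run a (shifted_matrix z s)} =
        space Alg - {a \<in> space Alg. run a (shifted_matrix z s)}" by auto
    have D: "schatten1 (shifted_matrix z s) > \<epsilon>\<^sub>0 * real n powr 1.5 \<Longrightarrow>
        prob {a \<in> space Alg. run a (shifted_matrix z s)} \<ge> 3 / 4"
      "schatten1 (shifted_matrix z s) < \<epsilon>\<^sub>0 * real n powr 1.5 - \<epsilon> * real n powr 1.5 \<Longrightarrow>
        prob {a \<in> space Alg. \<not> run a (shifted_matrix z s)} \<ge> 3 / 4"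
      using dist inp[OF s] by (auto simp: distinguishes_def)
    show ?thesis
    proof (cases "s \<in> signings 0")
      case True
      have "schatten1 (shifted_matrix z s) > \<epsilon>\<^sub>0 * real n powr 1.5"
        using large schatten1_hidden_matrix[OF True] by (simp add: shifted_matrix_def)
      with True show ?thesis using D runs by (simp add: X_def c)
    next
      case False
      with s have "s \<in> signings 1" by simp
      then have "schatten1 (shifted_matrix z s) < \<epsilon>\<^sub>0 * real n powr 1.5 - \<epsilon> * real n powr 1.5"
        using small schatten1_hidden_matrix[of s 1] by (simp add: shifted_matrix_def)
      with False show ?thesis using D runs not_runs by (simp add: X_def c)
    qed
  qed
  have count: "(\<Sum>c\<in>C. of_bool (a \<in> X c)) \<le> real (card (signings 0)) * (real (card shifts) + real (card (bad_shifts (fst a))))"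
    if a: "a \<in> space Alg" for a
  proof -
    have S: "fst a \<subseteq> {..<n} \<times> {..<n}" using alg a by (auto simp: nonadaptive_algorithm_def)
    have "(\<Sum>c\<in>C. of_bool (a \<in> X c)) = (\<Sum>z\<in>shifts. \<Sum>s\<in>signings 0 \<union> signings 1.
        of_bool (run a (shifted_matrix z s) = (s \<in> signings 0)) :: real)"
      unfolding C_def sum.cartesian_product using a by (intro sum.cong refl) (auto simp: X_def)
    also have "\<dots> \<le> (\<Sum>z\<in>shifts. card (signings 0) * (1 + of_bool (z \<in> bad_shifts (fst a)) :: real))"
      by (intro sum_mono correct_answers_le S)
    also have "\<dots> = card (signings 0) * (\<Sum>z\<in>shifts. 1 + of_bool (z \<in> bad_shifts (fst a)) :: real)"
      by (simp only: sum_distrib_left)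
    also have "(\<Sum>z\<in>shifts. 1 + of_bool (z \<in> bad_shifts (fst a)) :: real) =
        real (card shifts) + real (card (bad_shifts (fst a)))"
    proof -
      have "shifts \<inter> {z. z \<in> bad_shifts (fst a)} = bad_shifts (fst a)" by (auto simp: bad_shifts_def)
      then show ?thesis by (simp add: sum.distrib finite_shifts sum_of_bool_eq)
    qed
    finally show ?thesis .
  qed
  have few_bad: "2 * card (bad_shifts (fst a)) < card shifts" if a: "a \<in> space Alg" for a
  proof (rule few_bad_shifts)
    have "fst a \<subseteq> {..<n} \<times> {..<n}" using alg a by (auto simp: nonadaptive_algorithm_def)
    then show "finite (fst a)" by (rule finite_subset) simp
    show "2 * card (fst a) \<le> M\<^sup>2" using num_queries_ge[OF alg a] few by linarith
  qed fact
  \<comment> \<open>Integrality turns the strict bound on bad shifts into a slack of 1/2 that is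
    uniform in the sampler and therefore survives integration.\<close>
  have bound: "(\<Sum>c\<in>C. of_bool (a \<in> X c)) \<le>
      real (card (signings 0)) * (3 / 2 * real (card shifts) - 1 / 2)" if a: "a \<in> space Alg" for a
  proof -
    have "real (card shifts) + real (card (bad_shifts (fst a))) \<le> 3 / 2 * real (card shifts) - 1 / 2"
      using few_bad[OF a] by linarith
    then show ?thesis
      using order_trans[OF count[OF a] mult_left_mono] by simp
  qed
  have "3 / 2 * real (card (signings 0)) * real (card shifts) = (\<Sum>c\<in>C. 3 / 4)"
    by (simp add: C_def card_cartesian_product card_all_signings del: One_nat_def)
  also have "\<dots> \<le> (\<Sum>c\<in>C. prob (X c))" using X_prob by (intro sum_mono) auto
  also have "\<dots> \<le> real (card (signings 0)) * (3 / 2 * real (card shifts) - 1 / 2)"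
  proof (rule sum_prob_le[OF _ _ bound])
    show "finite C" by (simp add: C_def finite_shifts finite_signings)
  qed (simp_all add: X_prob)
  finally have "real (card (signings 0)) \<le> 0" by (simp add: algebra_simps)
  then show False using signings_0_nonempty finite_signings by simp
qed

end

subsection \<open>Choice of parameters\<close>

text \<open>Odd, logarithmic in \<open>1 / \<epsilon>\<close>, and long enough that
  \<open>2 ^ K\<close> reaches \<open>1 / \<epsilon>\<^sup>2\<close> and beats the number of
  cycles.\<close>

definition cycle_length :: "real \<Rightarrow> nat" where
  "cycle_length \<epsilon> = 2 * nat \<lceil>2 * ln (1 / \<epsilon>)\<rceil> + 1"

text \<open>For \<open>n\<close> of order \<open>K * M * k\<close> the gap is at least of order
  \<open>M * k powr 1.5 / K\<close>; comparing its square with that of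
  \<open>\<epsilon> * n powr 1.5\<close> limits \<open>K ^ 5 * M * \<epsilon>\<^sup>2\<close> by a
  constant.\<close>

definition cycle_count :: "real \<Rightarrow> nat" where
  "cycle_count \<epsilon> = nat \<lfloor>1 / (256 * real (cycle_length \<epsilon>) ^ 5 * \<epsilon>\<^sup>2)\<rfloor>"

lemma inverse_square_le_two_power_cycle_length:
  assumes "0 < \<epsilon>" "\<epsilon> < 1"
  shows "1 / \<epsilon>\<^sup>2 \<le> 2 ^ cycle_length \<epsilon>"
proof -
  have l: "ln (1 / \<epsilon>) > 0" using assms by simp
  have "1 / \<epsilon>\<^sup>2 = exp (2 * ln (1 / \<epsilon>))"
    using assms by (simp add: exp_double power_divide)
  also have "\<dots> \<le> exp (real (cycle_length \<epsilon>) * ln 2)"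
  proof -
    have "4 * ln (1 / \<epsilon>) \<le> real (cycle_length \<epsilon>)"
      using l by (simp add: cycle_length_def) linarith
    then have "4 * ln (1 / \<epsilon>) * (1 / 2) \<le> real (cycle_length \<epsilon>) * ln 2"
      using l ln2_ge_two_thirds by (intro mult_mono) auto
    then show ?thesis by simp
  qed
  also have "\<dots> = 2 ^ cycle_length \<epsilon>"
    by (simp add: exp_of_nat_mult)
  finally show ?thesis .
qed

section \<open>Size and gap of the two norms\<close>

context hidden_cycles
begin

lemma h_bounds: "1 / real K \<le> h" "1 / (2 * real K) \<le> sin h"
proof -
  show 1: "1 / real K \<le> h"
    using K pi_ge_two by (simp add: h_def field_simps)
  have "cos (pi / 3) \<le> cos h"
    using h by (intro cos_monotone_0_pi_le) auto
  then have "h * (1 / 2) \<le> h * cos h"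
    using h by (simp add: cos_60)
  also have "\<dots> \<le> sin h" using h by (intro mult_cos_le_sin) auto
  finally show "1 / (2 * real K) \<le> sin h" using 1 by simp
qed

definition amplitude :: real where "amplitude = real M * real k * sqrt (real k / 2)"

lemma amplitude: "amplitude > 0" "amplitude\<^sup>2 = (real M)\<^sup>2 * real k ^ 3 / 2"
proof -
  show "amplitude > 0" using M k by (simp add: amplitude_def)
  have "amplitude\<^sup>2 = (real M)\<^sup>2 * (real k)\<^sup>2 * (real k / 2)"
    by (simp add: amplitude_def power_mult_distrib)
  then show "amplitude\<^sup>2 = (real M)\<^sup>2 * real k ^ 3 / 2"
    by (simp add: power2_eq_square power3_eq_cube)
qed

lemma powr_3_2_square: "(real n powr 1.5)\<^sup>2 = real n ^ 3"
proof -
  have "real n > 0" using fits M k by (cases n) auto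
  have "(real n powr 1.5)\<^sup>2 = real n powr (1.5 * real 2)"
    by (subst powr_powr[symmetric]) (simp add: \<open>real n > 0\<close>)
  then show ?thesis using \<open>real n > 0\<close> by (simp add: powr_numeral)
qed

text \<open>The gap is \<open>amplitude\<close> times \<open>2 * (1 - cos h) / sin h\<close>, hence
  at least \<open>amplitude / K\<close>. Comparing squares, the cubed factor 2 from the rounding of
  \<open>k\<close> costs 8, and \<open>8 / 256\<close> is below \<open>1 / 2\<close>.\<close>

lemma schatten1_gap:
  assumes "n \<le> 2 * (K * M * k)" "real K ^ 5 * real M * \<epsilon>\<^sup>2 \<le> 1 / 256" "0 < \<epsilon>"
  shows "\<epsilon> * real n powr 1.5 < amplitude * (2 / sin h) - amplitude * (2 * cos h / sin h)"
proof -
  have "(\<epsilon> * real n powr 1.5 * real K)\<^sup>2 = \<epsilon>\<^sup>2 * real n ^ 3 * (real K)\<^sup>2"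
    by (simp only: power_mult_distrib powr_3_2_square)
  also have "\<dots> \<le> \<epsilon>\<^sup>2 * (2 * (real K * real M * real k)) ^ 3 * (real K)\<^sup>2"
  proof -
    have "real n \<le> real (2 * (K * M * k))" using assms(1) by (simp only: of_nat_le_iff)
    then show ?thesis by (intro mult_right_mono mult_left_mono power_mono) simp_all
  qed
  also have "\<dots> = 8 * (real K ^ 5 * real M * \<epsilon>\<^sup>2) * ((real M)\<^sup>2 * real k ^ 3)"
    by (simp add: power_mult_distrib) (simp add: eval_nat_numeral)
  also have "\<dots> \<le> 8 * (1 / 256) * ((real M)\<^sup>2 * real k ^ 3)"
    by (intro mult_right_mono mult_left_mono assms(2)) auto
  also have "\<dots> < (real M)\<^sup>2 * real k ^ 3 / 2"
    using M k by simp
  also have "\<dots> = amplitude\<^sup>2"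
    by (simp add: amplitude(2))
  finally have "\<epsilon> * real n powr 1.5 * real K < amplitude"
    by (rule power2_less_imp_less) (use amplitude in simp)
  then have "\<epsilon> * real n powr 1.5 < amplitude * (1 / real K)"
    using K by (simp add: field_simps)
  also have "\<dots> \<le> amplitude * (2 * (1 - cos h) / sin h)"
  proof (rule mult_left_mono)
    have "sin h > 0" using h by (intro sin_gt_zero) auto
    moreover have "h / 2 * sin h \<le> 1 - cos h" using h by (intro mult_sin_le_one_minus_cos) auto
    ultimately have "h \<le> 2 * (1 - cos h) / sin h" by (simp add: pos_le_divide_eq)
    with h_bounds(1) show "1 / real K \<le> 2 * (1 - cos h) / sin h" by linarith
  qed (use amplitude in simp)
  finally show ?thesis by (simp add: right_diff_distrib diff_divide_distrib)
qed

text \<open>Shows that the threshold exceeds \<epsilon> by at most a polylogarithmic factor: one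
  \<open>K\<close> comes from \<open>1 / sin h\<close>, the other from comparing
  \<open>amplitude\<close> with \<open>\<epsilon> * n powr 1.5\<close> by squares.\<close>

lemma schatten1_upper_bound:
  assumes "1 \<le> 512 * (real K ^ 5 * real M * \<epsilon>\<^sup>2)" "0 < \<epsilon>"
  shows "amplitude * (2 / sin h) \<le> 64 * (real K)\<^sup>2 * \<epsilon> * real n powr 1.5"
proof -
  have "amplitude\<^sup>2 * 1 \<le> amplitude\<^sup>2 * (512 * (real K ^ 5 * real M * \<epsilon>\<^sup>2))"
    by (intro mult_left_mono assms(1)) simp
  also have "\<dots> = (real M)\<^sup>2 * real k ^ 3 * (256 * (real K ^ 5 * real M * \<epsilon>\<^sup>2))"
    by (simp add: amplitude(2))
  also have "\<dots> = 256 * (real K)\<^sup>2 * \<epsilon>\<^sup>2 * (real K * real M * real k) ^ 3"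
    by (simp add: power_mult_distrib) (simp add: eval_nat_numeral)
  also have "\<dots> \<le> 256 * (real K)\<^sup>2 * \<epsilon>\<^sup>2 * real n ^ 3"
  proof -
    have "K * M * k \<le> n" using fits by (simp add: K_def)
    then have "real (K * M * k) \<le> real n" by (simp only: of_nat_le_iff)
    then show ?thesis by (intro mult_left_mono power_mono) simp_all
  qed
  also have "\<dots> = (16 * real K * \<epsilon> * real n powr 1.5)\<^sup>2"
    by (simp only: power_mult_distrib powr_3_2_square) simp
  finally have "amplitude\<^sup>2 \<le> (16 * real K * \<epsilon> * real n powr 1.5)\<^sup>2" by simp
  then have *: "amplitude \<le> 16 * real K * \<epsilon> * real n powr 1.5"
    by (rule power2_le_imp_le) (use assms(2) in simp)
  have "0 < 1 / (2 * real K)" using K by simp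
  moreover from this have "0 < sin h" using h_bounds(2) by (rule less_le_trans)
  ultimately have "2 / sin h \<le> 2 / (1 / (2 * real K))"
    using h_bounds(2) by (intro divide_left_mono mult_pos_pos) auto
  then have "2 / sin h \<le> 4 * real K" by simp
  then have "amplitude * (2 / sin h) \<le> amplitude * (4 * real K)"
    using amplitude(1) by (intro mult_left_mono) auto
  also have "\<dots> \<le> (16 * real K * \<epsilon> * real n powr 1.5) * (4 * real K)"
    by (intro mult_right_mono *) simp
  finally show ?thesis by (simp add: power2_eq_square mult_ac)
qed

end

lemma hard_threshold:
  assumes n: "n \<ge> 1" and \<epsilon>: "1 / sqrt (real n) \<le> \<epsilon>" "\<epsilon> < 1" and M: "cycle_count \<epsilon> \<ge> 1"
  shows "\<exists>\<epsilon>\<^sub>0. \<epsilon> < \<epsilon>\<^sub>0 \<and> \<epsilon>\<^sub>0 \<le> 64 * (real (cycle_length \<epsilon>))\<^sup>2 * \<epsilon> \<and>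
    (\<forall>Alg. nonadaptive_algorithm n Alg \<longrightarrow> distinguishes n \<epsilon>\<^sub>0 \<epsilon> Alg \<longrightarrow>
      (cycle_count \<epsilon>)\<^sup>2 div 2 \<le> num_queries Alg)"
proof -
  define L where "L = nat \<lceil>2 * ln (1 / \<epsilon>)\<rceil>"
  define K where "K = 2 * L + 1"
  define M where "M = cycle_count \<epsilon>"
  \<comment> \<open>The largest block side that fits; once it is at least 1, rounding loses at most
    a factor 2 of \<open>n\<close>.\<close>
  define k where "k = n div (K * M)"
  have "0 < 1 / sqrt (real n)" using n by simp
  with \<epsilon> have "0 < \<epsilon>" by linarith
  have K_eq: "cycle_length \<epsilon> = K" by (simp add: K_def L_def cycle_length_def)
  have "L \<ge> 1" using \<open>0 < \<epsilon>\<close> \<epsilon>(2) by (simp add: L_def Suc_le_eq)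
  have M1: "M \<ge> 1" using M by (simp add: M_def)
  define r where "r = 1 / (256 * real K ^ 5 * \<epsilon>\<^sup>2)"
  have M_eq: "M = nat \<lfloor>r\<rfloor>" by (simp add: M_def cycle_count_def K_eq r_def)
  have Mr: "real M \<le> r" "r < real M + 1" using M1 unfolding M_eq by linarith+
  have r_pos: "256 * real K ^ 5 * \<epsilon>\<^sup>2 > 0" using \<open>0 < \<epsilon>\<close> by (simp add: K_def)
  have "real M * (256 * real K ^ 5 * \<epsilon>\<^sup>2) \<le> 1"
    using Mr(1) r_pos by (simp add: r_def field_simps)
  then have lower: "real K ^ 5 * real M * \<epsilon>\<^sup>2 \<le> 1 / 256" by (simp add: mult_ac)
  have "r \<le> 2 * real M" using Mr M1 by linarith
  then have "1 \<le> 2 * real M * (256 * real K ^ 5 * \<epsilon>\<^sup>2)"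
    using r_pos by (simp add: r_def field_simps)
  then have upper: "1 \<le> 512 * (real K ^ 5 * real M * \<epsilon>\<^sup>2)" by (simp add: mult_ac)
  have "real K * real M * \<epsilon>\<^sup>2 \<le> real K ^ 5 * real M * \<epsilon>\<^sup>2"
    by (intro mult_right_mono self_le_power) (auto simp: K_def)
  with lower have KM\<epsilon>: "real (K * M) * \<epsilon>\<^sup>2 \<le> 1" by simp
  \<comment> \<open>Here the restriction to \<epsilon> at least \<open>1 / sqrt n\<close> enters: it
    leaves room for \<open>K * M\<close> blocks.\<close>
  have "1 / real n \<le> \<epsilon>\<^sup>2"
    using power_mono[OF \<epsilon>(1), of 2] n by (simp add: power_divide)
  then have "real (K * M) * (1 / real n) \<le> 1"
    using KM\<epsilon> mult_left_mono[of "1 / real n" "\<epsilon>\<^sup>2" "real (K * M)"] by simp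
  then have "real (K * M) \<le> real n" using n by (simp add: field_simps)
  then have KMn: "K * M \<le> n" by (simp only: of_nat_le_iff)
  have KM0: "K * M > 0" using M1 by (simp add: K_def)
  have k1: "k \<ge> 1" using KMn KM0 by (simp add: k_def Suc_le_eq div_greater_zero_iff)
  have fits: "K * M * k \<le> n" by (simp add: k_def)
  have "n = K * M * k + n mod (K * M)" by (simp add: k_def)
  also have "\<dots> \<le> K * M * k + K * M" using KM0 by (simp add: less_imp_le)
  also have "\<dots> \<le> 2 * (K * M * k)" using k1 by simp
  finally have half: "n \<le> 2 * (K * M * k)" .
  interpret H: hidden_cycles n L M k
    using \<open>L \<ge> 1\<close> M1 k1 fits by unfold_locales (simp_all add: K_def)
  have HK: "H.K = K" by (simp add: K_def H.K_def)
  have "2 * M < 2 ^ K"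
  proof -
    have "1 * real M * \<epsilon>\<^sup>2 \<le> real K ^ 5 * real M * \<epsilon>\<^sup>2"
      by (intro mult_right_mono one_le_power) (auto simp: K_def)
    with lower have "2 * real M * \<epsilon>\<^sup>2 < 1" by linarith
    then have "2 * real M < 1 / \<epsilon>\<^sup>2" using \<open>0 < \<epsilon>\<close> by (simp add: field_simps)
    also have "\<dots> \<le> 2 ^ K"
      using inverse_square_le_two_power_cycle_length[OF \<open>0 < \<epsilon>\<close> \<epsilon>(2)] by (simp add: K_eq)
    finally have "real (2 * M) < real (2 ^ K)" by simp
    then show ?thesis by (simp only: of_nat_less_iff)
  qed
  define N where "N = real n powr 1.5"
  have "N > 0" using n by (simp add: N_def)
  define big small where "big = H.amplitude * (2 / sin H.h)" and "small = H.amplitude * (2 * cos H.h / sin H.h)"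
  have gap: "\<epsilon> * N < big - small"
    unfolding N_def big_def small_def by (rule H.schatten1_gap[unfolded HK, OF half lower \<open>0 < \<epsilon>\<close>])
  have "small \<ge> 0"
    using H.amplitude H.h sin_gt_zero[of H.h] cos_ge_zero[of H.h] by (auto simp: small_def)
  \<comment> \<open>Places \<open>\<epsilon>\<^sub>0 * N\<close> midway between
    \<open>small + \<epsilon> * N\<close> and \<open>big\<close>, so that both strict inequalities
    follow from the gap.\<close>
  define \<epsilon>\<^sub>0 where "\<epsilon>\<^sub>0 = (big + small + \<epsilon> * N) / (2 * N)"
  have \<epsilon>\<^sub>0: "\<epsilon>\<^sub>0 * N = (big + small + \<epsilon> * N) / 2"
    using \<open>N > 0\<close> by (simp add: \<epsilon>\<^sub>0_def)
  have "\<epsilon> * N < \<epsilon>\<^sub>0 * N" using gap \<open>small \<ge> 0\<close> unfolding \<epsilon>\<^sub>0 by argo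
  then have "\<epsilon> < \<epsilon>\<^sub>0" using \<open>N > 0\<close> by simp
  have "\<epsilon>\<^sub>0 * N \<le> big" using gap unfolding \<epsilon>\<^sub>0 by argo
  also have "big \<le> 64 * (real K)\<^sup>2 * \<epsilon> * N"
    unfolding big_def N_def by (rule H.schatten1_upper_bound[unfolded HK, OF upper \<open>0 < \<epsilon>\<close>])
  finally have "\<epsilon>\<^sub>0 \<le> 64 * (real K)\<^sup>2 * \<epsilon>" using \<open>N > 0\<close> by simp
  moreover have "M\<^sup>2 div 2 \<le> num_queries Alg"
    if "nonadaptive_algorithm n Alg" "distinguishes n \<epsilon>\<^sub>0 \<epsilon> Alg" for Alg
  proof (rule H.many_queries_needed[unfolded HK, OF that \<open>2 * M < 2 ^ K\<close>])
    show "\<epsilon>\<^sub>0 * real n powr 1.5 < real M * real k * sqrt (real k / 2) * (2 / sin H.h)"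
      using gap unfolding N_def[symmetric] \<epsilon>\<^sub>0 H.amplitude_def[symmetric] big_def[symmetric] by argo
    show "real M * real k * sqrt (real k / 2) * (2 * cos H.h / sin H.h)
        < \<epsilon>\<^sub>0 * real n powr 1.5 - \<epsilon> * real n powr 1.5"
      using gap unfolding N_def[symmetric] \<epsilon>\<^sub>0 H.amplitude_def[symmetric] small_def[symmetric] by argo
  qed
  ultimately show ?thesis
    using \<open>\<epsilon> < \<epsilon>\<^sub>0\<close> by (auto simp: K_eq M_def)
qed

section \<open>Asymptotics for small accuracy parameters\<close>

lemma regime_pos:
  assumes "(n, \<epsilon>) \<in> regime"
  shows "0 < \<epsilon>"
proof -
  have "0 < 1 / sqrt (real n)" "1 / sqrt (real n) \<le> \<epsilon>" using assms by (auto simp: regime_def)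
  then show ?thesis by linarith
qed

lemma eventually_regime:
  assumes "eventually P (at_right 0)"
  shows "eventually (\<lambda>(n, \<epsilon>). (n, \<epsilon>) \<in> regime \<and> P \<epsilon>) eps_to_0"
proof -
  obtain \<delta> where "\<delta> > 0" and \<delta>: "\<And>\<epsilon>. 0 < \<epsilon> \<Longrightarrow> \<epsilon> < \<delta> \<Longrightarrow> P \<epsilon>"
    using assms unfolding eventually_at_right_field by blast
  show ?thesis
    unfolding eventually_eps_to_0 using \<open>\<delta> > 0\<close> \<delta> regime_pos by (intro exI[of _ \<delta>]) auto
qed

text \<open>The cycle length is linear in the logarithm; the cycle count is then at least a constant
  over \<open>ln (1 / \<epsilon>) ^ 5 * \<epsilon>\<^sup>2\<close>, and squaring produces the tenth
  power.\<close>

lemma eventually_parameters: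
  "eventually (\<lambda>\<epsilon>. \<epsilon> < 1 \<and> cycle_count \<epsilon> \<ge> 1 \<and> ln (1 / \<epsilon>) > 0 \<and>
     real (cycle_length \<epsilon>) \<le> 7 * ln (1 / \<epsilon>) \<and>
     1 / \<epsilon> ^ 4 / ln (1 / \<epsilon>) ^ 10 \<le> 4 * (512 * 7 ^ 5)\<^sup>2 * real ((cycle_count \<epsilon>)\<^sup>2 div 2)) (at_right 0)"
proof -
  \<comment> \<open>The factor \<open>5 ^ 5\<close> comes from bounding the logarithm by 5 times the
    fifth root of \<open>1 / \<epsilon>\<close>.\<close>
  define \<delta> :: real where "\<delta> = 1 / (512 * 7 ^ 5 * 5 ^ 5)"
  have "eventually (\<lambda>\<epsilon>. 0 < \<epsilon> \<and> \<epsilon> < \<delta>) (at_right 0)"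
    unfolding eventually_at_right_field by (intro exI[of _ \<delta>]) (auto simp: \<delta>_def)
  then show ?thesis
  proof eventually_elim
    case (elim \<epsilon>)
    define l where "l = ln (1 / \<epsilon>)"
    define K where "K = cycle_length \<epsilon>"
    define M where "M = cycle_count \<epsilon>"
    from elim have "0 < \<epsilon>" "\<epsilon> < 1 / 3" by (auto simp: \<delta>_def)
    then have "\<epsilon> < 1" by simp
    have "exp 1 \<le> 1 / \<epsilon>"
      using exp_le \<open>0 < \<epsilon>\<close> \<open>\<epsilon> < 1 / 3\<close> by (simp add: field_simps order_trans)
    then have l: "1 \<le> l" using \<open>0 < \<epsilon>\<close> unfolding l_def by (subst ln_ge_iff) auto
    have small: "512 * 7 ^ 5 * l ^ 5 * \<epsilon>\<^sup>2 \<le> 1"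
    proof -
      have "l \<le> 5 * (1 / \<epsilon>) powr (1 / 5)"
        using ln_powr_bound[of "1 / \<epsilon>" "1 / 5"] \<open>0 < \<epsilon>\<close> \<open>\<epsilon> < 1\<close> by (simp add: l_def)
      then have "l ^ 5 \<le> (5 * (1 / \<epsilon>) powr (1 / 5)) ^ 5"
        using l by (intro power_mono) auto
      also have "\<dots> = 5 ^ 5 * ((1 / \<epsilon>) powr (1 / 5)) powr real 5"
        using \<open>0 < \<epsilon>\<close> by (subst powr_realpow) (auto simp: power_mult_distrib)
      also have "\<dots> = 5 ^ 5 * (1 / \<epsilon>)"
        using \<open>0 < \<epsilon>\<close> by (simp add: powr_powr)
      finally have "512 * 7 ^ 5 * l ^ 5 * \<epsilon>\<^sup>2 \<le> 512 * 7 ^ 5 * (5 ^ 5 * (1 / \<epsilon>)) * \<epsilon>\<^sup>2"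
        by (intro mult_right_mono mult_left_mono) auto
      also have "\<dots> = 512 * 7 ^ 5 * 5 ^ 5 * \<epsilon>"
        using \<open>0 < \<epsilon>\<close> by (simp add: power2_eq_square)
      also have "\<dots> \<le> 1" using elim by (simp add: \<delta>_def)
      finally show ?thesis .
    qed
    have "real K \<le> 2 * (2 * l + 1) + 1"
      using l unfolding K_def cycle_length_def l_def by simp linarith
    also have "\<dots> \<le> 7 * l" using l by simp
    finally have K: "real K \<le> 7 * l" .
    have K0: "real K > 0" by (simp add: K_def cycle_length_def)
    have "2 / (512 * 7 ^ 5 * l ^ 5 * \<epsilon>\<^sup>2) = 1 / (256 * (7 * l) ^ 5 * \<epsilon>\<^sup>2)"
      by (simp add: power_mult_distrib)
    also have "\<dots> \<le> 1 / (256 * real K ^ 5 * \<epsilon>\<^sup>2)"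
      using K K0 l \<open>0 < \<epsilon>\<close> by (intro divide_left_mono mult_mono power_mono) auto
    also have "\<dots> < real M + 1"
      unfolding M_def cycle_count_def K_def by linarith
    finally have M1: "2 / (512 * 7 ^ 5 * l ^ 5 * \<epsilon>\<^sup>2) < real M + 1" .
    \<comment> \<open>Half of the lower bound for \<open>M + 1\<close>, so that
      \<open>c \<ge> 1\<close> absorbs the rounding and also gives \<open>M \<ge> 2\<close>.\<close>
    define c where "c = 1 / (512 * 7 ^ 5 * l ^ 5 * \<epsilon>\<^sup>2)"
    have "1 \<le> c" using small l \<open>0 < \<epsilon>\<close> by (simp add: c_def field_simps)
    have "2 * c < real M + 1" using M1 by (simp add: c_def)
    then have "c \<le> real M" "2 \<le> M" using \<open>1 \<le> c\<close> by linarith+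
    have "1 / \<epsilon> ^ 4 / l ^ 10 = (512 * 7 ^ 5)\<^sup>2 * c\<^sup>2"
      using l \<open>0 < \<epsilon>\<close> by (simp add: c_def power_mult_distrib power_divide flip: power_mult)
    also have "\<dots> \<le> (512 * 7 ^ 5)\<^sup>2 * (real M)\<^sup>2"
      using \<open>1 \<le> c\<close> \<open>c \<le> real M\<close> by (intro mult_left_mono power_mono) auto
    also have "(real M)\<^sup>2 \<le> 4 * real (M\<^sup>2 div 2)"
    proof -
      have "2\<^sup>2 \<le> M\<^sup>2" using \<open>2 \<le> M\<close> by (rule power_mono) simp
      then have "M\<^sup>2 \<le> 4 * (M\<^sup>2 div 2)" by simp
      then have "real (M\<^sup>2) \<le> real (4 * (M\<^sup>2 div 2))" by (simp only: of_nat_le_iff)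
      then show ?thesis by simp
    qed
    finally show ?case
      using \<open>\<epsilon> < 1\<close> \<open>2 \<le> M\<close> l K by (simp add: l_def K_def M_def)
  qed
qed

theorem mainTheorem5:
  shows "\<exists>(\<epsilon>\<^sub>0 :: nat \<Rightarrow> real \<Rightarrow> real) (q :: nat \<Rightarrow> real \<Rightarrow> nat).
    (\<lambda>(n, \<epsilon>). \<epsilon>\<^sub>0 n \<epsilon>) \<in> soft_bigtheta (\<lambda>(n, \<epsilon>). \<epsilon>) \<and>
    (\<lambda>(n, \<epsilon>). real (q n \<epsilon>)) \<in> soft_bigomega (\<lambda>(n, \<epsilon>). 1 / \<epsilon> ^ 4) \<and>
    (\<forall>(n :: nat) (\<epsilon> :: real). n \<ge> 1 \<longrightarrow> 1 / sqrt (real n) \<le> \<epsilon> \<longrightarrow> \<epsilon> \<le> 1 \<longrightarrow>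
       \<epsilon>\<^sub>0 n \<epsilon> > 0 \<and>
       (\<forall>M. nonadaptive_algorithm n M \<longrightarrow> distinguishes n (\<epsilon>\<^sub>0 n \<epsilon>) \<epsilon> M \<longrightarrow>
          num_queries M \<ge> q n \<epsilon>))"
proof -
  define good where "good \<epsilon> \<longleftrightarrow> \<epsilon> < 1 \<and> cycle_count \<epsilon> \<ge> 1" for \<epsilon>
  \<comment> \<open>Where the construction does not apply, the trivial bound 0 is used; this happens
    only for \<epsilon> away from 0 and does not affect the asymptotics.\<close>
  define q where "q n \<epsilon> = (if good \<epsilon> then (cycle_count \<epsilon>)\<^sup>2 div 2 else 0)" for n :: nat and \<epsilon>
  have "\<exists>e. (n, \<epsilon>) \<in> regime \<longrightarrow> e > 0 \<and>
      (good \<epsilon> \<longrightarrow> \<epsilon> < e \<and> e \<le> 64 * (real (cycle_length \<epsilon>))\<^sup>2 * \<epsilon>) \<and>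
      (\<forall>M. nonadaptive_algorithm n M \<longrightarrow> distinguishes n e \<epsilon> M \<longrightarrow> q n \<epsilon> \<le> num_queries M)" for n \<epsilon>
  proof (cases "(n, \<epsilon>) \<in> regime \<and> good \<epsilon>")
    case True
    then have n\<epsilon>: "n \<ge> 1" "1 / sqrt (real n) \<le> \<epsilon>" "\<epsilon> < 1" "cycle_count \<epsilon> \<ge> 1"
      by (auto simp: regime_def good_def)
    have "0 < \<epsilon>" using True regime_pos by blast
    from hard_threshold[OF n\<epsilon>] show ?thesis
      using True \<open>0 < \<epsilon>\<close> by (auto simp: q_def intro: less_trans)
  next
    case False
    \<comment> \<open>Any positive threshold serves here, as the query bound is 0 or the parameters
      are inadmissible.\<close>
    then show ?thesis by (intro exI[of _ 1]) (auto simp: q_def)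
  qed
  then obtain \<epsilon>\<^sub>0 where \<epsilon>\<^sub>0: "\<And>n \<epsilon>. (n, \<epsilon>) \<in> regime \<Longrightarrow> \<epsilon>\<^sub>0 n \<epsilon> > 0"
    "\<And>n \<epsilon>. (n, \<epsilon>) \<in> regime \<Longrightarrow> good \<epsilon> \<Longrightarrow>
      \<epsilon> < \<epsilon>\<^sub>0 n \<epsilon> \<and> \<epsilon>\<^sub>0 n \<epsilon> \<le> 64 * (real (cycle_length \<epsilon>))\<^sup>2 * \<epsilon>"
    "\<And>n \<epsilon> M. (n, \<epsilon>) \<in> regime \<Longrightarrow> nonadaptive_algorithm n M \<Longrightarrow> distinguishes n (\<epsilon>\<^sub>0 n \<epsilon>) \<epsilon> M \<Longrightarrow>
      q n \<epsilon> \<le> num_queries M"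
    by metis
  note ev = eventually_regime[OF eventually_parameters]
  have "(\<lambda>(n, \<epsilon>). \<epsilon>\<^sub>0 n \<epsilon>) \<in> O[eps_to_0](\<lambda>(n, \<epsilon>). \<epsilon> * ln (1 / \<epsilon>) ^ 2)"
  proof (rule bigoI[of _ "64 * 7\<^sup>2"], rule eventually_mono[OF ev], clarify)
    fix n \<epsilon> assume *: "(n, \<epsilon>) \<in> regime" "\<epsilon> < 1" "cycle_count \<epsilon> \<ge> 1" "ln (1 / \<epsilon>) > 0"
      "real (cycle_length \<epsilon>) \<le> 7 * ln (1 / \<epsilon>)"
    have "\<epsilon>\<^sub>0 n \<epsilon> \<le> 64 * (real (cycle_length \<epsilon>))\<^sup>2 * \<epsilon>"
      using \<epsilon>\<^sub>0(2)[OF *(1)] * by (simp add: good_def)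
    also have "\<dots> \<le> 64 * (7 * ln (1 / \<epsilon>))\<^sup>2 * \<epsilon>"
      using * regime_pos[OF *(1)] by (intro mult_right_mono mult_left_mono power_mono) auto
    finally show "norm (\<epsilon>\<^sub>0 n \<epsilon>) \<le> 64 * 7\<^sup>2 * norm (\<epsilon> * ln (1 / \<epsilon>) ^ 2)"
      using \<epsilon>\<^sub>0(1)[OF *(1)] regime_pos[OF *(1)] by (simp add: power_mult_distrib abs_mult mult_ac)
  qed
  then have "(\<lambda>(n, \<epsilon>). \<epsilon>\<^sub>0 n \<epsilon>) \<in> soft_bigo (\<lambda>(n, \<epsilon>). \<epsilon>)"
    by (auto simp: soft_bigo_def case_prod_unfold)
  \<comment> \<open>From below no logarithm is lost, since the threshold exceeds \<epsilon>
    itself.\<close>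
  moreover have "(\<lambda>(n, \<epsilon>). \<epsilon>\<^sub>0 n \<epsilon>) \<in> \<Omega>[eps_to_0](\<lambda>(n, \<epsilon>). \<epsilon> / ln (1 / \<epsilon>) ^ 0)"
  proof (rule landau_omega.bigI[of 1], simp, rule eventually_mono[OF ev], clarify)
    fix n \<epsilon> assume *: "(n, \<epsilon>) \<in> regime" "\<epsilon> < 1" "cycle_count \<epsilon> \<ge> 1"
    then show "norm (\<epsilon>\<^sub>0 n \<epsilon>) \<ge> 1 * norm (\<epsilon> / ln (1 / \<epsilon>) ^ 0)"
      using \<epsilon>\<^sub>0(2)[OF *(1)] regime_pos[OF *(1)] by (simp add: good_def)
  qed
  then have "(\<lambda>(n, \<epsilon>). \<epsilon>\<^sub>0 n \<epsilon>) \<in> soft_bigomega (\<lambda>(n, \<epsilon>). \<epsilon>)"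
    unfolding soft_bigomega_def by (intro UN_I[of 0]) (simp_all add: case_prod_unfold)
  moreover have "(\<lambda>(n, \<epsilon>). real (q n \<epsilon>)) \<in> \<Omega>[eps_to_0](\<lambda>(n, \<epsilon>). 1 / \<epsilon> ^ 4 / ln (1 / \<epsilon>) ^ 10)"
  proof (rule landau_omega.bigI[of "1 / (4 * (512 * 7 ^ 5)\<^sup>2)"], simp, rule eventually_mono[OF ev], clarify)
    fix n \<epsilon> assume *: "(n, \<epsilon>) \<in> regime" "\<epsilon> < 1" "cycle_count \<epsilon> \<ge> 1" "ln (1 / \<epsilon>) > 0"
      "1 / \<epsilon> ^ 4 / ln (1 / \<epsilon>) ^ 10 \<le> 4 * (512 * 7 ^ 5)\<^sup>2 * real ((cycle_count \<epsilon>)\<^sup>2 div 2)"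
    have "norm (1 / \<epsilon> ^ 4 / ln (1 / \<epsilon>) ^ 10) = 1 / \<epsilon> ^ 4 / ln (1 / \<epsilon>) ^ 10"
      using * regime_pos[OF *(1)] by simp
    also have "\<dots> \<le> 4 * (512 * 7 ^ 5)\<^sup>2 * real (q n \<epsilon>)"
      using * by (simp only: q_def good_def) simp
    finally show "norm (real (q n \<epsilon>)) \<ge> 1 / (4 * (512 * 7 ^ 5)\<^sup>2) * norm (1 / \<epsilon> ^ 4 / ln (1 / \<epsilon>) ^ 10)"
      by simp
  qed
  then have "(\<lambda>(n, \<epsilon>). real (q n \<epsilon>)) \<in> soft_bigomega (\<lambda>(n, \<epsilon>). 1 / \<epsilon> ^ 4)"
    unfolding soft_bigomega_def by (intro UN_I[of 10]) (simp_all add: case_prod_unfold)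
  ultimately show ?thesis
    using \<epsilon>\<^sub>0(1,3) by (intro exI[of _ \<epsilon>\<^sub>0] exI[of _ q]) (simp add: soft_bigtheta_def regime_def)
qed

end
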